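(* (TNN braid limit theorem) Let $\mathbf i\to\mathbf j$ be a braid limit between infinite reduced words, and let $\mathbf a\in\ell^1_{>0}$. Then $$e_{\mathbf i}(\mathbf a)=e_{\mathbf j}(R_{\mathbf i}^{\mathbf j}(\mathbf a)).$$
   Context: Elements of $GL_n(\mathbb R((t)))$ are identified with their unfoldings, the $\mathbb Z\times\mathbb Z$ matrices $(x_{i,j})$ with $x_{i+n,j+n}=x_{i,j}$ and $a_{ij}(t)=\sum_kx_{i,j+kn}t^k$. For $i\in\mathbb Z/n\mathbb Z$, $e_i(a)$ is the identity except for entries $a$ at positions $(kn+i,kn+i+1)$, $k\in\mathbb Z$. For an infinite word $\mathbf i=i_1i_2\cdots$ in $\mathbb Z/n\mathbb Z$ and $\mathbf a\in\ell^1_{>0}$ (positive real sequences with finite sum), $e_{\mathbf i}(\mathbf a)=\lim_ke_{i_1}(a_1)\cdots e_{i_k}(a_k)$ (entrywise; the limit exists). An infinite word is reduced if each prefix $s_{i_1}\cdots s_{i_k}$ has length $k$ in the affine symmetric group. A braid limit $\mathbf i\to\mathbf j$ is a sequence $\mathbf i=\mathbf j_0,\mathbf j_1,\dots$ of infinite words with the following properties: - each $\mathbf j_{k+1}$ arises from $\mathbf j_k$ by finitely many braid moves: $ij\leftrightarrow ji$ for commuting $s_i,s_j$, or $i(i+1)i\leftrightarrow(i+1)i(i+1)$; - $\mathbf j_k\to\mathbf j$ coordinatewise. $R_{\mathbf i}^{\mathbf j}:\ell^1_{>0}\to\ell^1_{>0}$ transports parameters along the braid limit as follows: - a commutation move swaps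 the two corresponding parameters; - a move $i(i+1)i\to(i+1)i(i+1)$, or $(i+1)i(i+1)\to i(i+1)i$, on consecutive parameters $(a,b,c)$ replaces them by $(bc/(a+c),\,a+c,\,ab/(a+c))$. Each coordinate eventually stabilizes, and $R_{\mathbf i}^{\mathbf j}(\mathbf a)$ is the limit. It lies in $\ell^1_{>0}$ and is independent of the chosen braid limit from $\mathbf i$ to $\mathbf j$. *)

theory Defs
  imports "HOL-Analysis.Analysis"
begin

text \<open>
  Letters in \<open>\<int>/n\<int>\<close> are represented by the natural numbers below \<open>n\<close>.
  Words and parameter sequences are indexed from \<open>0\<close>, so \<open>w k\<close> stands for \<open>i\<^sub>k\<^sub>+\<^sub>1\<close>.
  Elements of \<open>GL\<^sub>n(\<real>((t)))\<close> are given by their unfoldings.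
\<close>

type_synonym word = "nat \<Rightarrow> nat"
type_synonym params = "nat \<Rightarrow> real"
type_synonym unfolded = "int \<Rightarrow> int \<Rightarrow> real"

definition ell1_pos :: "params set" where
  "ell1_pos = {a. (\<forall>k. 0 < a k) \<and> summable a}"


subsection \<open>Unfolded matrices and Chevalley generators\<close>

definition unfolded_one :: unfolded where
  "unfolded_one r c = (if r = c then 1 else 0)"

text \<open>
  For unfoldings of matrices over \<open>\<real>((t))\<close> the sum has only finitely many nonzero terms.
\<close>

definition unfolded_mult :: "unfolded \<Rightarrow> unfolded \<Rightarrow> unfolded" where
  "unfolded_mult X Y r c = (\<Sum>\<^sub>\<infinity>k\<in>UNIV. X r k * Y k c)"

definition chevalley :: "nat \<Rightarrow> nat \<Rightarrow> real \<Rightarrow> unfolded" where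
  "chevalley n i x r c =
     (if \<exists>k. r = k * int n + int i \<and> c = k * int n + int i + 1 then x else unfolded_one r c)"

primrec chevalley_prefix :: "nat \<Rightarrow> word \<Rightarrow> params \<Rightarrow> nat \<Rightarrow> unfolded" where
  "chevalley_prefix n w a 0 = unfolded_one"
| "chevalley_prefix n w a (Suc k) =
     unfolded_mult (chevalley_prefix n w a k) (chevalley n (w k) (a k))"

definition chevalley_word :: "nat \<Rightarrow> word \<Rightarrow> params \<Rightarrow> unfolded" where
  "chevalley_word n w a r c = lim (\<lambda>k. chevalley_prefix n w a k r c)"


subsection \<open>Reduced words in the affine symmetric group\<close>

text \<open>
  The affine symmetric group (for \<open>n \<ge> 2\<close>) is realised by \<open>n\<close>-periodic permutations of \<open>\<int>\<close>;
  the simple reflection \<open>s\<^sub>i\<close> exchanges \<open>kn + i\<close> and \<open>kn + i + 1\<close> for all \<open>k\<close>.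
\<close>

definition simple_refl :: "nat \<Rightarrow> nat \<Rightarrow> int \<Rightarrow> int" where
  "simple_refl n i x =
     (if x mod int n = int i mod int n then x + 1
      else if x mod int n = (int i + 1) mod int n then x - 1
      else x)"

definition refl_prod :: "nat \<Rightarrow> nat list \<Rightarrow> int \<Rightarrow> int" where
  "refl_prod n us = foldr (\<lambda>i f. simple_refl n i \<circ> f) us id"

definition affine_length :: "nat \<Rightarrow> (int \<Rightarrow> int) \<Rightarrow> nat" where
  "affine_length n f =
     (LEAST l. \<exists>us. length us = l \<and> set us \<subseteq> {..<n} \<and> refl_prod n us = f)"

definition reduced_word :: "nat \<Rightarrow> word \<Rightarrow> bool" where
  "reduced_word n w \<longleftrightarrow>
     (\<forall>k. w k < n) \<and> (\<forall>k. affine_length n (refl_prod n (map w [0..<k])) = k)"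


subsection \<open>Braid limits\<close>

definition refl_commute :: "nat \<Rightarrow> nat \<Rightarrow> nat \<Rightarrow> bool" where
  "refl_commute n i j \<longleftrightarrow>
     simple_refl n i \<circ> simple_refl n j = simple_refl n j \<circ> simple_refl n i"

text \<open>
  For \<open>n = 2\<close> the group is infinite dihedral and has no relation
  \<open>s\<^sub>i s\<^sub>j s\<^sub>i = s\<^sub>j s\<^sub>i s\<^sub>j\<close>, hence the condition \<open>2 < n\<close>.
\<close>

definition braid_adjacent :: "nat \<Rightarrow> nat \<Rightarrow> nat \<Rightarrow> bool" where
  "braid_adjacent n i j \<longleftrightarrow> 2 < n \<and> (j = (i + 1) mod n \<or> i = (j + 1) mod n)"

inductive braid_move :: "nat \<Rightarrow> word \<Rightarrow> word \<Rightarrow> bool" for n where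
  "refl_commute n (w p) (w (p + 1)) \<Longrightarrow>
   braid_move n w (w(p := w (p + 1), p + 1 := w p))"
| "braid_adjacent n (w p) (w (p + 1)) \<Longrightarrow> w (p + 2) = w p \<Longrightarrow>
   braid_move n w (w(p := w (p + 1), p + 1 := w p, p + 2 := w (p + 1)))"

definition braid_limit :: "nat \<Rightarrow> (nat \<Rightarrow> word) \<Rightarrow> word \<Rightarrow> word \<Rightarrow> bool" where
  "braid_limit n W i j \<longleftrightarrow>
     W 0 = i \<and> (\<forall>k. (braid_move n)\<^sup>*\<^sup>* (W k) (W (Suc k))) \<and>
     (\<forall>m. \<forall>\<^sub>F k in sequentially. W k m = j m)"


subsection \<open>Transport of parameters\<close>

inductive transport_move :: "nat \<Rightarrow> word \<times> params \<Rightarrow> word \<times> params \<Rightarrow> bool" for n where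
  "refl_commute n (w p) (w (p + 1)) \<Longrightarrow>
   transport_move n (w, a)
     (w(p := w (p + 1), p + 1 := w p),
      a(p := a (p + 1), p + 1 := a p))"
| "braid_adjacent n (w p) (w (p + 1)) \<Longrightarrow> w (p + 2) = w p \<Longrightarrow>
   transport_move n (w, a)
     (w(p := w (p + 1), p + 1 := w p, p + 2 := w (p + 1)),
      a(p := a (p + 1) * a (p + 2) / (a p + a (p + 2)),
        p + 1 := a p + a (p + 2),
        p + 2 := a p * a (p + 1) / (a p + a (p + 2))))"

text \<open>
  \<open>transports_along n W a A\<close>: the parameters \<open>a\<close> of \<open>W 0\<close> become the parameters \<open>A k\<close> of \<open>W k\<close>
  along some choice of the finitely many moves leading from each word of \<open>W\<close> to the next.
\<close>

definition transports_along ::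
    "nat \<Rightarrow> (nat \<Rightarrow> word) \<Rightarrow> params \<Rightarrow> (nat \<Rightarrow> params) \<Rightarrow> bool" where
  "transports_along n W a A \<longleftrightarrow>
     A 0 = a \<and> (\<forall>k. (transport_move n)\<^sup>*\<^sup>* (W k, A k) (W (Suc k), A (Suc k)))"

text \<open>
  The unique limit of transported parameters, over all braid limits from \<open>i\<close> to \<open>j\<close> and all
  choices of moves realising them. The description is meaningful when \<open>i\<close> and \<open>j\<close> are reduced,
  a braid limit from \<open>i\<close> to \<open>j\<close> exists, and \<open>a\<close> lies in \<open>ell1_pos\<close>.
\<close>

definition braid_R :: "nat \<Rightarrow> word \<Rightarrow> word \<Rightarrow> params \<Rightarrow> params" where
  "braid_R n i j a =
     (THE b. \<exists>W A. braid_limit n W i j \<and> transports_along n W a A \<and>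
                   (\<forall>m. (\<lambda>k. A k m) \<longlonglongrightarrow> b m))"

end

theory Submission
  imports Defs
begin

text \<open>
  For every stage of a braid limit, a prefix of the current word together with its tail gives the
  matrix of a finite prefix of \<open>i\<close>, and the parameters of a reduced word are determined by its matrix and
  its permutation; so the transported parameters stabilise, and every finite prefix of
  \<open>e\<^sub>j(b)\<close>, where \<open>b\<close> is the limit, is a left factor of a finite prefix of \<open>e\<^sub>i(a)\<close>, the other
  factor being again a product of Chevalley generators with positive parameters.
  What has to be excluded is that parameters escape to infinity, that is, that
  the total sum of \<open>b\<close> is smaller than the sum of \<open>a\<close>.

  An infinite reduced word \<open>j\<close> moves some residue classes \<open>L\<close> of values infinitely far to the left of
  the others, and then so does \<open>i\<close>. Words in which elements of \<open>L\<close> hop to the left over the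
  others are therefore initial factors of both. By induction on the number \<open>N\<close> of
  leading letters of \<open>i\<close>, such hopping factors carry at least the sum of the first \<open>N\<close> parameters, up
  to \<open>\<epsilon>\<close>: a first letter which does not start the hopping word commutes past a long
  hopping word, and the ratio of two neighbouring matrix entries far from the diagonal bounds the
  parameter with which it comes out by the sum of the parameters at the end of that word.
\<close>

text \<open>The obstacle is that a braid limit is one-sided: finite prefixes of j are initial
  factors of prefixes of i, but in general not conversely, so the two products cannot be compared
  prefix by prefix. The total mass decides instead. It can be read off the matrix, as the sum of the
  superdiagonal over one period, and a right factor of mass d raises an entry by at most d times the
  entry to its left in the product. These entries are bounded in terms of the sum of a, so it
  suffices that the cofactors of the prefixes of j have arbitrarily small mass.

  Hopping words are common ground because only inversions decide whether they can be split off, and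
  every inversion made by j is also made by i. The bound on an outgoing parameter c comes from a row
  in which a long hopping word has positive entries beyond the band of its short initial piece:
  there the ratio of two neighbouring entries is at least c, because of the last generator, and at
  most the mass of the part appended to the short piece.\<close>

locale affine_words =
  fixes n :: nat
  assumes n2: "2 \<le> n"
begin

section \<open>Simple reflections and words as periodic permutations of the integers\<close>

abbreviation sr :: "nat \<Rightarrow> int \<Rightarrow> int" where
  "sr \<equiv> simple_refl n"

lemma mod_Suc_neq: "(x + 1) mod int n \<noteq> x mod int n"
proof
  assume "(x + 1) mod int n = x mod int n"
  then have "int n dvd (x + 1) - x"
    by (simp add: mod_eq_dvd_iff)
  then show False
    using n2 by auto
qed

lemma mod_Suc_cong: "x mod int n = y mod int n \<Longrightarrow> (x + 1) mod int n = (y + 1) mod int n"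
  by (metis mod_add_left_eq)

lemma mod_Suc_cancel: "(x + 1) mod int n = (y + 1) mod int n \<Longrightarrow> x mod int n = y mod int n"
  by (simp add: mod_eq_dvd_iff)

lemma mod_pred: "x mod int n = (y + 1) mod int n \<Longrightarrow> (x - 1) mod int n = y mod int n"
  using mod_Suc_cancel[of "x - 1" y] by simp

lemma sr_up: "x mod int n = int i mod int n \<Longrightarrow> sr i x = x + 1"
  by (simp add: simple_refl_def)

lemma sr_down: "x mod int n = (int i + 1) mod int n \<Longrightarrow> sr i x = x - 1"
  using mod_Suc_neq[of "int i"] by (simp add: simple_refl_def)

lemma sr_fix:
  "x mod int n \<noteq> int i mod int n \<Longrightarrow> x mod int n \<noteq> (int i + 1) mod int n \<Longrightarrow> sr i x = x"
  by (simp add: simple_refl_def)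

lemma sr_shift: "sr i (x + k * int n) = sr i x + k * int n"
  by (simp add: simple_refl_def)

lemma sr_sr [simp]: "sr i (sr i x) = x"
proof -
  consider "x mod int n = int i mod int n" | "x mod int n = (int i + 1) mod int n"
    | "x mod int n \<noteq> int i mod int n" "x mod int n \<noteq> (int i + 1) mod int n"
    by blast
  then show ?thesis
  proof cases
    case 1
    then show ?thesis
      using sr_down[of "x + 1" i] mod_Suc_cong[of x "int i"] by (simp add: sr_up)
  next
    case 2
    then show ?thesis
      using sr_up[of "x - 1" i] mod_pred[of x "int i"] by (simp add: sr_down)
  next
    case 3
    then show ?thesis by (simp add: sr_fix)
  qed
qed

lemma sr_self [simp]: "sr i (int i) = int i + 1" "sr i (int i + 1) = int i"
  by (simp_all add: sr_up sr_down)

lemma mod_eqD: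
  assumes "x mod int n = y mod int n"
  obtains k where "x = y + k * int n"
proof -
  have "int n dvd x - y"
    using assms by (simp add: mod_eq_dvd_iff)
  then obtain k where "x - y = int n * k" ..
  then have "x = y + k * int n"
    by (simp add: algebra_simps)
  then show ?thesis ..
qed

text \<open>The inverse of the permutation \<open>refl_prod n u\<close>: the position of a value in its one-line notation.\<close>

primrec pos :: "nat list \<Rightarrow> int \<Rightarrow> int" where
  "pos [] x = x"
| "pos (s # u) x = pos u (sr s x)"

lemma pos_append: "pos (u @ v) x = pos v (pos u x)"
  by (induction u arbitrary: x) auto

lemma pos_shift: "pos u (x + k * int n) = pos u x + k * int n"
  by (induction u arbitrary: x) (auto simp: sr_shift)

lemma refl_prod_simps: "refl_prod n [] = id" "refl_prod n (s # u) = sr s \<circ> refl_prod n u"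
  by (simp_all add: refl_prod_def)

lemma refl_prod_pos: "refl_prod n u (pos u x) = x"
  by (induction u arbitrary: x) (simp_all add: refl_prod_simps)

lemma pos_refl_prod: "pos u (refl_prod n u x) = x"
  by (induction u arbitrary: x) (simp_all add: refl_prod_simps)

lemma pos_eq_iff_refl_prod: "pos u = pos v \<longleftrightarrow> refl_prod n u = refl_prod n v"
proof
  assume "pos u = pos v"
  then show "refl_prod n u = refl_prod n v"
    by (metis ext pos_refl_prod refl_prod_pos)
next
  assume "refl_prod n u = refl_prod n v"
  then show "pos u = pos v"
    by (metis ext pos_refl_prod refl_prod_pos)
qed

lemma pos_inj: "pos u x = pos u y \<longleftrightarrow> x = y"
  by (metis refl_prod_pos)

lemma pos_surj: obtains x where "pos u x = p"
  using pos_refl_prod by blast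

lemma pos_mod_cong: "pos u x mod int n = pos u y mod int n \<longleftrightarrow> x mod int n = y mod int n"
proof
  assume "pos u x mod int n = pos u y mod int n"
  then obtain k where "pos u x = pos u y + k * int n"
    by (rule mod_eqD)
  then have "x = y + k * int n"
    by (metis pos_inj pos_shift)
  then show "x mod int n = y mod int n"
    by simp
next
  assume "x mod int n = y mod int n"
  then obtain k where "x = y + k * int n"
    by (rule mod_eqD)
  then show "pos u x mod int n = pos u y mod int n"
    by (simp add: pos_shift)
qed

section \<open>Reduced words and the exchange condition\<close>

definition reduced_list :: "nat list \<Rightarrow> bool" where
  "reduced_list u \<longleftrightarrow> set u \<subseteq> {..<n} \<and> (\<forall>v. set v \<subseteq> {..<n} \<longrightarrow> pos v = pos u \<longrightarrow> length u \<le> length v)"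

lemma pos_append_cong: "pos u = pos u' \<Longrightarrow> pos v = pos v' \<Longrightarrow> pos (u @ v) = pos (u' @ v')"
  by (auto simp: pos_append fun_eq_iff)

lemma pos_Cons_cong: "pos u = pos u' \<Longrightarrow> pos (s # u) = pos (s # u')"
  by (auto simp: fun_eq_iff)

lemma reduced_list_letters: "reduced_list u \<Longrightarrow> set u \<subseteq> {..<n}"
  by (simp add: reduced_list_def)

lemma reduced_list_le: "reduced_list u \<Longrightarrow> set v \<subseteq> {..<n} \<Longrightarrow> pos v = pos u \<Longrightarrow> length u \<le> length v"
  by (simp add: reduced_list_def)

lemma reduced_list_appendD:
  assumes "reduced_list (u @ v)"
  shows "reduced_list u" "reduced_list v"
proof -
  show "reduced_list u"
    unfolding reduced_list_def
  proof (intro conjI allI impI)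
    show "set u \<subseteq> {..<n}"
      using assms by (simp add: reduced_list_def)
    fix w assume "set w \<subseteq> {..<n}" "pos w = pos u"
    then have "length (u @ v) \<le> length (w @ v)"
      using reduced_list_le[OF assms,
          of "w @ v"] reduced_list_letters[OF assms] pos_append_cong[of w u v v] by simp
    then show "length u \<le> length w" by simp
  qed
  show "reduced_list v"
    unfolding reduced_list_def
  proof (intro conjI allI impI)
    show "set v \<subseteq> {..<n}"
      using assms by (simp add: reduced_list_def)
    fix w assume "set w \<subseteq> {..<n}" "pos w = pos v"
    then have "length (u @ v) \<le> length (u @ w)"
      using reduced_list_le[OF assms,
          of "u @ w"] reduced_list_letters[OF assms] pos_append_cong[of u u w v] by simp
    then show "length v \<le> length w" by simp
  qed
qed

lemma reduced_list_ConsD: "reduced_list (s # u) \<Longrightarrow> reduced_list u"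
  using reduced_list_appendD(2)[of "[s]" u] by simp

lemma reduced_list_cong:
  "reduced_list u \<Longrightarrow> set v \<subseteq> {..<n} \<Longrightarrow> pos v = pos u \<Longrightarrow> length v = length u \<Longrightarrow> reduced_list v"
  by (auto simp: reduced_list_def)

text \<open>Conjugation: u carries the exchange of the values s, s + 1 to the exchange of the
  neighbouring sites that they occupy, so the letter s passes through u and comes out as t.\<close>

lemma pos_commute:
  assumes "pos u (int s + 1) = pos u (int s) + 1" and t: "int t mod int n = pos u (int s) mod int n"
  shows "pos (s # u) = pos (u @ [t])"
proof
  fix x
  consider "x mod int n = int s mod int n" | "x mod int n = (int s + 1) mod int n"
    | "x mod int n \<noteq> int s mod int n" "x mod int n \<noteq> (int s + 1) mod int n"
    by blast
  then show "pos (s # u) x = pos (u @ [t]) x"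
  proof cases
    case 1
    then obtain k where k: "x = int s + k * int n"
      by (rule mod_eqD)
    have "pos u (x + 1) = pos u (int s + 1 + k * int n)"
      by (simp add: k algebra_simps)
    also have "\<dots> = pos u x + 1"
      by (simp add: pos_shift assms(1) k)
    finally have "pos (s # u) x = pos u x + 1"
      using 1 by (simp add: sr_up)
    moreover have "pos u x mod int n = int t mod int n"
      using 1 t by (simp add: pos_mod_cong)
    ultimately show ?thesis
      by (simp add: pos_append sr_up)
  next
    case 2
    then obtain k where k: "x = int s + 1 + k * int n"
      by (rule mod_eqD)
    have "pos u x = pos u (int s) + 1 + k * int n"
      by (simp add: pos_shift assms(1) k)
    moreover have "pos u (x - 1) = pos u (int s) + k * int n"
      using pos_shift[of u "int s" k] by (simp add: k)
    moreover have "pos u x mod int n = (int t + 1) mod int n"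
      using 2 mod_Suc_cong[OF t] by (metis assms(1) pos_mod_cong)
    ultimately show ?thesis
      using 2 by (simp add: pos_append sr_down)
  next
    case 3
    then have "pos u x mod int n \<noteq> int t mod int n"
      using t by (simp add: pos_mod_cong)
    moreover have "pos u x mod int n \<noteq> (int t + 1) mod int n"
      using 3(2) mod_Suc_cong[OF t] by (metis assms(1) pos_mod_cong)
    ultimately show ?thesis
      using 3 by (simp add: pos_append sr_fix)
  qed
qed

lemma sr_inverts:
  assumes "p < q" "sr t q < sr t p"
  shows "q = p + 1" "p mod int n = int t mod int n"
proof -
  have "sr t p \<le> p + 1" "sr t q \<ge> q - 1"
    by (auto simp: simple_refl_def)
  then have q: "q = p + 1 \<or> q = p + 2 - 1 \<or> q < p + 2"
    using assms by linarith
  then show q1: "q = p + 1"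
    using assms by linarith
  show "p mod int n = int t mod int n"
  proof (rule ccontr)
    assume a: "p mod int n \<noteq> int t mod int n"
    then have "sr t p \<le> p"
      by (auto simp: simple_refl_def)
    moreover have "sr t q \<ge> q"
      using a mod_Suc_cancel[of p "int t"] by (auto simp: simple_refl_def q1)
    ultimately show False
      using assms by linarith
  qed
qed

text \<open>Follow the values s and s + 1 through u. They start in order and end reversed, so some
  letter t makes them cross; only neighbours can cross, hence \<open>pos_commute\<close> applies to
  the part of u before t.\<close>

lemma exchange:
  assumes "pos u (int s + 1) < pos u (int s)"
  obtains u1 t u2 where "u = u1 @ t # u2" "pos (s # u1) = pos (u1 @ [t])"
  using assms
proof (induction u arbitrary: thesis rule: rev_induct)
  case Nil
  then show ?case by simp
next
  case (snoc t u)
  show ?case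
  proof (cases "pos u (int s + 1) < pos u (int s)")
    case True
    then obtain u1 t' u2 where "u = u1 @ t' # u2" "pos (s # u1) = pos (u1 @ [t'])"
      using snoc.IH by blast
    then show ?thesis
      using snoc.prems(1)[of u1 t' "u2 @ [t]"] by simp
  next
    case False
    moreover have "pos u (int s + 1) \<noteq> pos u (int s)"
      by (simp add: pos_inj)
    ultimately have "pos u (int s) < pos u (int s + 1)"
      by simp
    with snoc.prems(2) have "pos u (int s + 1) = pos u (int s) + 1"
      "pos u (int s) mod int n = int t mod int n"
      using sr_inverts by (auto simp: pos_append)
    then show ?thesis
      using snoc.prems(1)[of u t "[]"] pos_commute[of u s t] by simp
  qed
qed

text \<open>Moving s through u1 puts a second t next to the first one, and the two cancel.\<close>

lemma exchange_delete:
  assumes "u = u1 @ t # u2" "pos (s # u1) = pos (u1 @ [t])"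
  shows "pos (s # u) = pos (u1 @ u2)"
proof
  fix x
  have "pos (s # u) x = pos (t # u2) (pos (s # u1) x)"
    by (simp add: assms(1) pos_append)
  also have "\<dots> = pos (u1 @ u2) x"
    by (simp only: assms(2)) (simp add: pos_append)
  finally show "pos (s # u) x = pos (u1 @ u2) x" .
qed

text \<open>Otherwise \<open>exchange_delete\<close> would represent the same permutation with two
  letters fewer.\<close>

lemma reduced_list_ascent:
  assumes "reduced_list (s # u)"
  shows "pos u (int s) < pos u (int s + 1)"
proof (rule ccontr)
  assume "\<not> ?thesis"
  moreover have "pos u (int s) \<noteq> pos u (int s + 1)"
    by (simp add: pos_inj)
  ultimately have "pos u (int s + 1) < pos u (int s)"
    by simp
  then obtain u1 t u2 where u: "u = u1 @ t # u2" "pos (s # u1) = pos (u1 @ [t])"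
    by (rule exchange)
  have "set (u1 @ u2) \<subseteq> {..<n}"
    using assms u(1) by (auto simp: reduced_list_def)
  then have "length (s # u) \<le> length (u1 @ u2)"
    using reduced_list_le[OF assms] exchange_delete[OF u] by metis
  then show False
    using u(1) by simp
qed

text \<open>The letter found by \<open>exchange\<close> is deleted and s is put in front instead;
  permutation and length stay the same.\<close>

lemma descent_first:
  assumes "reduced_list u" "s < n" "pos u (int s + 1) < pos u (int s)"
  obtains u' where "reduced_list (s # u')" "pos (s # u') = pos u" "length (s # u') = length u"
proof -
  obtain u1 t u2 where u: "u = u1 @ t # u2" "pos (s # u1) = pos (u1 @ [t])"
    using assms(3) by (rule exchange)
  have "pos (s # u1 @ u2) x = pos u x" for x
  proof -
    have "pos (s # u1 @ u2) x = pos (u1 @ u2) (sr s x)"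
      by simp
    also have "\<dots> = pos (s # u) (sr s x)"
      using exchange_delete[OF u] by metis
    finally show ?thesis by simp
  qed
  then have *: "pos (s # u1 @ u2) = pos u" ..
  have len: "length (s # u1 @ u2) = length u"
    by (simp add: u(1))
  have "set (s # u1 @ u2) \<subseteq> {..<n}"
    using assms(1,2) u(1) by (auto simp: reduced_list_def)
  then show ?thesis
    using that[of "u1 @ u2"] reduced_list_cong[OF assms(1) _ * len] * len by blast
qed

section \<open>Chevalley generators as column and row operations\<close>

definition rmul :: "nat \<Rightarrow> real \<Rightarrow> unfolded \<Rightarrow> unfolded" where
  "rmul i a X r c = X r c + (if (c - 1) mod int n = int i mod int n then a * X r (c - 1) else 0)"

definition lmul :: "nat \<Rightarrow> real \<Rightarrow> unfolded \<Rightarrow> unfolded" where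
  "lmul i a X r c = X r c + (if r mod int n = int i mod int n then a * X (r + 1) c else 0)"

lemma rmul_hit: "(c - 1) mod int n = int i mod int n \<Longrightarrow> rmul i a X r c = X r c + a * X r (c - 1)"
  by (simp add: rmul_def)

lemma rmul_miss: "(c - 1) mod int n \<noteq> int i mod int n \<Longrightarrow> rmul i a X r c = X r c"
  by (simp add: rmul_def)

lemma lmul_rmul: "lmul i a (rmul j b X) = rmul j b (lmul i a X)"
  by (auto simp: lmul_def rmul_def fun_eq_iff algebra_simps)

lemma rmul_one: "rmul i a unfolded_one = lmul i a unfolded_one"
  by (auto simp: lmul_def rmul_def fun_eq_iff unfolded_one_def)

lemma lmul_lmul: "lmul i a (lmul i b X) = lmul i (a + b) X"
proof (intro ext)
  fix r c
  show "lmul i a (lmul i b X) r c = lmul i (a + b) X r c"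
    using mod_Suc_neq[of r]
    by (cases "r mod int n = int i mod int n") (simp_all add: lmul_def algebra_simps)
qed

lemma lmul_0: "lmul i 0 X = X"
  by (auto simp: lmul_def fun_eq_iff)

primrec mult_word :: "unfolded \<Rightarrow> (nat \<times> real) list \<Rightarrow> unfolded" where
  "mult_word X [] = X"
| "mult_word X (p # ps) = mult_word (rmul (fst p) (snd p) X) ps"

abbreviation word_matrix :: "(nat \<times> real) list \<Rightarrow> unfolded" where
  "word_matrix \<equiv> mult_word unfolded_one"

lemma mult_word_append: "mult_word X (ps @ qs) = mult_word (mult_word X ps) qs"
  by (induction ps arbitrary: X) auto

lemma mult_word_lmul: "mult_word (lmul i a X) ps = lmul i a (mult_word X ps)"
  by (induction ps arbitrary: X) (auto simp: lmul_rmul[symmetric])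

lemma word_matrix_Cons: "word_matrix ((s, a) # ps) = lmul s a (word_matrix ps)"
  by (simp add: rmul_one mult_word_lmul)

lemma word_matrix_append_cong: "word_matrix qs = word_matrix qs'
    \<Longrightarrow> word_matrix (ps @ qs) = word_matrix (ps @ qs')"
proof (induction ps)
  case (Cons p ps)
  then show ?case
    using word_matrix_Cons[of "fst p" "snd p"] by simp
qed simp

section \<open>Positivity, total mass and the band of a product\<close>

definition positive :: "(nat \<times> real) list \<Rightarrow> bool" where
  "positive ps \<longleftrightarrow> (\<forall>p\<in>set ps. 0 < snd p)"

lemma positive_simps [simp]:
  "positive []" "positive (p # ps) \<longleftrightarrow> 0 < snd p \<and> positive ps"
    "positive (ps @ qs) \<longleftrightarrow> positive ps \<and> positive qs"
  by (auto simp: positive_def)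

definition nonneg :: "unfolded \<Rightarrow> bool" where
  "nonneg X \<longleftrightarrow> (\<forall>r c. 0 \<le> X r c)"

lemma nonneg_one: "nonneg unfolded_one"
  by (simp add: nonneg_def unfolded_one_def)

lemma nonneg_rmul: "nonneg X \<Longrightarrow> 0 \<le> a \<Longrightarrow> nonneg (rmul i a X)"
  by (simp add: nonneg_def rmul_def)

lemma rmul_ge: "nonneg X \<Longrightarrow> 0 \<le> a \<Longrightarrow> X r c \<le> rmul i a X r c"
  by (simp add: nonneg_def rmul_def)

lemma nonneg_mult_word: "nonneg X \<Longrightarrow> positive ps \<Longrightarrow> nonneg (mult_word X ps)"
  by (induction ps arbitrary: X) (auto simp: nonneg_rmul)

lemma mult_word_ge: "nonneg X \<Longrightarrow> positive ps \<Longrightarrow> X r c \<le> mult_word X ps r c"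
proof (induction ps arbitrary: X)
  case (Cons p ps)
  then have "X r c \<le> rmul (fst p) (snd p) X r c"
    by (simp add: rmul_ge)
  also have "\<dots> \<le> mult_word X (p # ps) r c"
    using Cons by (simp add: nonneg_rmul)
  finally show ?case .
qed simp

definition mass :: "(nat \<times> real) list \<Rightarrow> real" where
  "mass ps = sum_list (map snd ps)"

lemma mass_simps [simp]:
  "mass [] = 0" "mass (p # ps) = snd p + mass ps" "mass (ps @ qs) = mass ps + mass qs"
  by (auto simp: mass_def)

lemma mass_nonneg: "positive ps \<Longrightarrow> 0 \<le> mass ps"
  by (induction ps) auto

text \<open>A factor adds to column c + 1 at most its parameter times the current entry in column c.
  Entries never decrease, so the final entry in column c bounds all these contributions at once. All
  later estimates of entries rest on this inequality.\<close>

lemma mult_word_superdiag_le: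
  assumes "nonneg X" "positive ps"
  shows "mult_word X ps r (c + 1) \<le> X r (c + 1) + mass ps * mult_word X ps r c"
  using assms(2)
proof (induction ps rule: rev_induct)
  case (snoc p ps)
  let ?Y = "mult_word X ps" and ?Z = "mult_word X (ps @ [p])"
  have p: "0 < snd p" "positive ps"
    using snoc.prems by auto
  have Y: "nonneg ?Y"
    using assms p by (simp add: nonneg_mult_word)
  have Z: "?Z = rmul (fst p) (snd p) ?Y"
    by (simp add: mult_word_append)
  have YZ: "?Y r c \<le> ?Z r c"
    using Y p by (simp add: Z rmul_ge)
  have "?Z r (c + 1) \<le> ?Y r (c + 1) + snd p * ?Y r c"
    using Y p by (simp add: Z rmul_def nonneg_def)
  also have "\<dots> \<le> X r (c + 1) + mass ps * ?Y r c + snd p * ?Y r c"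
    using snoc p by simp
  also have "\<dots> = X r (c + 1) + mass (ps @ [p]) * ?Y r c"
    by (simp add: algebra_simps)
  also have "\<dots> \<le> X r (c + 1) + mass (ps @ [p]) * ?Z r c"
    using YZ mass_nonneg[of "ps @ [p]"] snoc.prems by (simp add: mult_left_mono)
  finally show ?case .
qed simp

definition unitri :: "unfolded \<Rightarrow> bool" where
  "unitri X \<longleftrightarrow> (\<forall>r. X r r = 1 \<and> (\<forall>c<r. X r c = 0))"

lemma unitri_one: "unitri unfolded_one"
  by (simp add: unitri_def unfolded_one_def)

lemma unitri_rmul: "unitri X \<Longrightarrow> unitri (rmul i a X)"
  by (simp add: unitri_def rmul_def)

lemma unitri_mult_word: "unitri X \<Longrightarrow> unitri (mult_word X ps)"
  by (induction ps arbitrary: X) (auto simp: unitri_rmul)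

lemma sum_residue:
  "(\<Sum>x\<in>{0..<int n}. if x mod int n = y mod int n then a else 0) = (a :: 'a :: comm_monoid_add)"
proof -
  have "(\<Sum>x\<in>{0..<int n}. if x mod int n = y mod int n then a else 0)
      = (\<Sum>x\<in>{0..<int n}. if x = y mod int n then a else 0)"
    by (intro sum.cong) auto
  also have "\<dots> = a"
    using n2 by simp
  finally show ?thesis .
qed

text \<open>The superdiagonal of a product of unitriangular matrices is additive, and a generator
  contributes its parameter in exactly one residue. Hence the mass depends on the matrix and not on
  the word that represents it.\<close>

lemma superdiag_mult_word:
  assumes "unitri X" "fst ` set ps \<subseteq> {..<n}"
  shows "(\<Sum>x\<in>{0..<int n}. mult_word X ps x (x + 1)) = (\<Sum>x\<in>{0..<int n}. X x (x + 1)) + mass ps"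
  using assms
proof (induction ps arbitrary: X)
  case (Cons p ps)
  have "(\<Sum>x\<in>{0..<int n}. rmul (fst p) (snd p) X x (x + 1))
      = (\<Sum>x\<in>{0..<int n}. X x (x + 1) + (if x mod int n = int (fst p) mod int n then snd p else 0))"
    using Cons.prems by (intro sum.cong) (auto simp: rmul_def unitri_def)
  also have "\<dots> = (\<Sum>x\<in>{0..<int n}. X x (x + 1)) + snd p"
    using Cons.prems by (subst sum.distrib, subst sum_residue) auto
  finally show ?case
    using Cons by (simp add: unitri_rmul)
qed simp

lemma mass_eqI:
  assumes "word_matrix ps = word_matrix qs" "fst ` set ps \<subseteq> {..<n}" "fst ` set qs \<subseteq> {..<n}"
  shows "mass ps = mass qs"
  using superdiag_mult_word[OF unitri_one assms(2)] superdiag_mult_word[OF unitri_one assms(3)]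
      assms(1) by simp

text \<open>Each generator widens the band above the diagonal by one.\<close>

lemma word_matrix_far:
  assumes "int (length ps) < c - r"
  shows "word_matrix ps r c = 0"
  using assms
proof (induction ps arbitrary: c rule: rev_induct)
  case Nil
  then show ?case by (simp add: unfolded_one_def)
next
  case (snoc p ps)
  then show ?case by (simp add: mult_word_append rmul_def)
qed

subsection \<open>Relations between Chevalley generators\<close>

lemma rmul_commute:
  assumes "int s mod int n \<noteq> (int t + 1) mod int n" "int t mod int n \<noteq> (int s + 1) mod int n"
  shows "rmul t b (rmul s a X) = rmul s a (rmul t b X)"
proof (intro ext)
  fix r c
  have "(c - 1 - 1) mod int n \<noteq> int s mod int n \<or> (c - 1) mod int n \<noteq> int t mod int n"
    using assms(2) mod_Suc_cong[of "c - 1 - 1" "int s"] by auto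
  moreover have "(c - 1 - 1) mod int n \<noteq> int t mod int n \<or> (c - 1) mod int n \<noteq> int s mod int n"
    using assms(1) mod_Suc_cong[of "c - 1 - 1" "int t"] by auto
  ultimately show "rmul t b (rmul s a X) r c = rmul s a (rmul t b X) r c"
    by (auto simp: rmul_def)
qed

lemma mod_Suc_Suc_neq: "2 < n \<Longrightarrow> (x + 2) mod int n \<noteq> x mod int n"
proof
  assume n: "2 < n" and "(x + 2) mod int n = x mod int n"
  then have "int n dvd (x + 2) - x"
    by (simp only: mod_eq_dvd_iff)
  then have "int n \<le> 2"
    by (intro zdvd_imp_le) auto
  then show False
    using n by simp
qed

text \<open>Equations between old and new parameters replace the quotients, so that the relation can
  also be read backwards: the second form covers the case where s follows t, with the old parameters
  in the primed role.\<close>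

lemma rmul_braid_aux:
  fixes a b c a' b' c' :: real
  assumes n: "2 < n" and t: "int t mod int n = (int s + 1) mod int n"
    and eqs: "b' = a + c" "a' + c' = b" "b' * c' = a * b" "a' * b' = b * c"
  shows "rmul s c (rmul t b (rmul s a X)) = rmul t c' (rmul s b' (rmul t a' X))"
    and "rmul t c' (rmul s b' (rmul t a' X)) = rmul s c (rmul t b (rmul s a X))"
proof -
  have "rmul s c (rmul t b (rmul s a X)) r (y + 1) = rmul t c' (rmul s b' (rmul t a' X)) r (y + 1)"
    for r y
  proof -
    have st: "int s mod int n \<noteq> int t mod int n"
      using t mod_Suc_neq by metis
    have y: "(y - 1) mod int n \<noteq> y mod int n"
      using mod_Suc_neq[of "y - 1"] by simp
    consider "y mod int n = int s mod int n" | "y mod int n = int t mod int n"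
      | "y mod int n \<noteq> int s mod int n" "y mod int n \<noteq> int t mod int n"
      by blast
    then show ?thesis
    proof cases
      case 1
      have "(y - 1) mod int n \<noteq> int t mod int n"
      proof
        assume "(y - 1) mod int n = int t mod int n"
        then have "(y - 1 - 1) mod int n = int s mod int n"
          using mod_pred[of "y - 1" "int s"] t by simp
        then show False
          using mod_Suc_Suc_neq[OF n, of "y - 2"] 1 by simp
      qed
      then show ?thesis
        using 1 st y by (simp add: rmul_def eqs(1) distrib_right)
    next
      case 2
      have y1: "(y - 1) mod int n = int s mod int n"
        using mod_pred[of y "int s"] 2 t by simp
      have "rmul s c (rmul t b (rmul s a X)) r (y + 1) =
          X r (y + 1) + b * X r y + a * b * X r (y - 1)"
        using 2 st y y1 by (simp add: rmul_def distrib_left)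
      also have "\<dots> = X r (y + 1) + (a' + c') * X r y + b' * c' * X r (y - 1)"
        by (simp only: eqs(2,3))
      also have "\<dots> = rmul t c' (rmul s b' (rmul t a' X)) r (y + 1)"
        using 2 st y y1 mod_Suc_Suc_neq[OF n, of "y - 2"] by (simp add: rmul_def algebra_simps)
      finally show ?thesis .
    next
      case 3
      then show ?thesis by (simp add: rmul_def)
    qed
  qed
  then show "rmul s c (rmul t b (rmul s a X)) = rmul t c' (rmul s b' (rmul t a' X))"
    by (intro ext) (metis diff_add_cancel)
  then show "rmul t c' (rmul s b' (rmul t a' X)) = rmul s c (rmul t b (rmul s a X))" ..
qed

lemma rmul_braid:
  fixes a b c :: real
  assumes n: "2 < n" and pos: "0 < a + c"
    and t: "int t mod int n = (int s + 1) mod int n \<or> int s mod int n = (int t + 1) mod int n"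
  shows "rmul s c (rmul t b (rmul s a X)) =
    rmul t (a * b / (a + c)) (rmul s (a + c) (rmul t (b * c / (a + c)) X))"
proof -
  have "b * c / (a + c) + a * b / (a + c) = b * (a + c) / (a + c)"
    by (simp only: add_divide_distrib[symmetric] distrib_left mult.commute add.commute)
  also have "\<dots> = b"
    using pos by simp
  finally have eqs: "b * c / (a + c) + a * b / (a + c) = b"
    "(a + c) * (a * b / (a + c)) = a * b" "b * c / (a + c) * (a + c) = b * c"
    using pos by simp_all
  from t show ?thesis
  proof
    assume "int t mod int n = (int s + 1) mod int n"
    then show ?thesis
      using eqs by (intro rmul_braid_aux(1)[OF n]) auto
  next
    assume "int s mod int n = (int t + 1) mod int n"
    then show ?thesis
      using eqs by (intro rmul_braid_aux(2)[OF n]) (auto simp: mult.commute)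
  qed
qed

subsection \<open>Dependence on the reduced word\<close>

text \<open>Only the existence of positive parameters is recorded, so the rational formulas need not
  be composed along a chain of braid relations.\<close>

definition same_matrices :: "nat list \<Rightarrow> nat list \<Rightarrow> bool" where
  "same_matrices u v \<longleftrightarrow>
     (\<forall>ps. map fst ps = u \<longrightarrow> positive ps \<longrightarrow> (\<exists>qs. map fst qs = v \<and> positive qs
         \<and> word_matrix qs = word_matrix ps))"

lemma same_matricesE:
  assumes "same_matrices (map fst ps) v" "positive ps"
  obtains qs where "map fst qs = v" "positive qs" "word_matrix qs = word_matrix ps"
  using assms unfolding same_matrices_def by blast

lemma same_matrices_refl: "same_matrices u u"
  by (auto simp: same_matrices_def)

lemma same_matrices_trans: "same_matrices u v \<Longrightarrow> same_matrices v w \<Longrightarrow> same_matrices u w"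
  unfolding same_matrices_def by metis

lemma same_matrices_Cons:
  assumes "same_matrices u v"
  shows "same_matrices (s # u) (s # v)"
  unfolding same_matrices_def
proof (intro allI impI)
  fix ps assume ps: "map fst ps = s # u" "positive ps"
  then obtain a ps' where ps': "ps = (s, a) # ps'" "map fst ps' = u" "positive ps'" "0 < a"
    by (cases ps) auto
  then obtain qs where "map fst qs = v" "positive qs" "word_matrix qs = word_matrix ps'"
    using assms unfolding same_matrices_def by blast
  then show "\<exists>qs. map fst qs = s # v \<and> positive qs \<and> word_matrix qs = word_matrix ps"
    using ps' by (intro exI[of _ "(s, a) # qs"]) (simp only: word_matrix_Cons, simp)
qed

lemma same_matrices_commute:
  assumes "int s mod int n \<noteq> (int t + 1) mod int n" "int t mod int n \<noteq> (int s + 1) mod int n"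
  shows "same_matrices (s # t # u) (t # s # u)"
  unfolding same_matrices_def
proof (intro allI impI)
  fix ps assume "map fst ps = s # t # u" "positive ps"
  then obtain a b ps' where "ps = (s, a) # (t, b) # ps'" "map fst ps' = u" "positive ps'" "0 < a"
    "0 < b"
    by (cases ps; cases "tl ps") auto
  then show "\<exists>qs. map fst qs = t # s # u \<and> positive qs \<and> word_matrix qs = word_matrix ps"
    using rmul_commute[OF assms] by (intro exI[of _ "(t, b) # (s, a) # ps'"]) simp
qed

lemma same_matrices_braid:
  assumes "2 < n"
    and "int t mod int n = (int s + 1) mod int n \<or> int s mod int n = (int t + 1) mod int n"
  shows "same_matrices (s # t # s # u) (t # s # t # u)"
  unfolding same_matrices_def
proof (intro allI impI)
  fix ps assume "map fst ps = s # t # s # u" "positive ps"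
  then obtain a b c ps' where ps: "ps = (s, a) # (t, b) # (s, c) # ps'" "map fst ps' = u"
    "positive ps'"
    "0 < a" "0 < b" "0 < c"
    by (cases ps; cases "tl ps"; cases "tl (tl ps)") auto
  then show "\<exists>qs. map fst qs = t # s # t # u \<and> positive qs \<and> word_matrix qs = word_matrix ps"
    using rmul_braid[OF assms(1) _ assms(2), of a c b]
    by (intro exI[of _ "(t, b * c / (a + c)) # (s, a + c) # (t, a * b / (a + c)) # ps'"]) simp
qed

lemma reduced_list_length_eq: "reduced_list u \<Longrightarrow> reduced_list v \<Longrightarrow> pos u = pos v
    \<Longrightarrow> length u = length v"
  by (simp add: le_antisym reduced_list_le reduced_list_letters)

lemma pos_Cons_cancel: "pos (s # u) = pos (s # v) \<longleftrightarrow> pos u = pos v"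
proof
  assume eq: "pos (s # u) = pos (s # v)"
  have "pos u x = pos v x" for x
    using fun_cong[OF eq, of "sr s x"] by simp
  then show "pos u = pos v" ..
qed (rule pos_Cons_cong)

lemma adjacent_mod_neq:
  assumes "2 < n" "int t mod int n = (int s + 1) mod int n"
  shows "int s mod int n \<noteq> int t mod int n" "int s mod int n \<noteq> (int t + 1) mod int n"
proof -
  show "int s mod int n \<noteq> int t mod int n"
    using assms mod_Suc_neq[of "int s"] by simp
  have "(int t + 1) mod int n = (int s + 1 + 1) mod int n"
    using assms(2) by (rule mod_Suc_cong)
  then show "int s mod int n \<noteq> (int t + 1) mod int n"
    using mod_Suc_Suc_neq[OF assms(1), of "int s"] by (simp add: add.assoc)
qed

lemma pos_braid:
  assumes n: "2 < n" and t: "int t mod int n = (int s + 1) mod int n"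
  shows "pos [s, t, s] = pos [t, s, t]"
proof -
  note neq = adjacent_mod_neq[OF n t]
  have s2: "(int s + 2) mod int n = (int t + 1) mod int n"
    using mod_Suc_cong[OF t] by (simp add: add.assoc)
  have "sr t (int s) = int s"
    using neq by (simp add: sr_fix)
  moreover have "sr t (int s + 1) = int s + 2"
    using t by (simp add: sr_up)
  moreover have "sr s (int s + 2) = int s + 2"
    using neq s2 mod_Suc_neq[of "int s + 1"] mod_Suc_Suc_neq[OF n, of "int s"]
    by (intro sr_fix) (auto simp: add.assoc)
  ultimately show ?thesis
    using pos_commute[of "[t, s]" s t] t by simp
qed

text \<open>Both first letters are descents of the common permutation, so the sites of s, s + 1, s +
  2 decrease. Therefore x has a descent at t and, once t is removed, one at s: the longest element
  of the rank two subgroup splits off on the left.\<close>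

lemma dihedral_adjacent:
  assumes x: "reduced_list (s # x)" and y: "reduced_list (t # y)"
      and eq: "pos (s # x) = pos (t # y)"
    and t: "int t mod int n = (int s + 1) mod int n"
  obtains z where "2 < n" "reduced_list (t # s # z)" "pos (t # s # z) = pos x"
    "reduced_list (s # t # z)" "pos (s # t # z) = pos y"
proof -
  let ?P = "pos (s # x)"
  obtain k where k: "int t = int s + 1 + k * int n"
    using t by (rule mod_eqD)
  have P1: "?P (int s + 1) < ?P (int s)"
    using reduced_list_ascent[OF x] by simp
  have "pos (t # y) (int t + 1) < pos (t # y) (int t)"
    using reduced_list_ascent[OF y] by simp
  then have "?P (int s + 1 + k * int n + 1) < ?P (int s + 1 + k * int n)"
    unfolding eq[symmetric] k .
  moreover have "int s + 1 + k * int n + 1 = int s + 2 + k * int n"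
    by simp
  ultimately have P2: "?P (int s + 2) < ?P (int s + 1)"
    by (simp only: pos_shift add_less_cancel_right)
  \<comment> \<open>For n = 2 the value s + 2 is a translate of s and always lies to its right,
    whereas the sites just found decrease.\<close>
  have n: "2 < n"
  proof (rule ccontr)
    assume "\<not> 2 < n"
    then have "n = 2" using n2 by simp
    then have "?P (int s + 2) = ?P (int s) + 2"
      using pos_shift[of "s # x" "int s" 1] by simp
    then show False using P1 P2 by linarith
  qed
  note neq = adjacent_mod_neq[OF n t]
  have letters: "s < n" "t < n"
    using reduced_list_letters[OF x] reduced_list_letters[OF y] by auto
  have x_eq: "pos x w = ?P (sr s w)" for w
    by simp
  have s2: "sr s (int s + 2) = int s + 2"
    using neq mod_Suc_neq[of "int s + 1"] mod_Suc_Suc_neq[OF n, of "int s"]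
    by (intro sr_fix) (auto simp: add.assoc)
  have x1: "pos x (int s + 1) = ?P (int s)" "pos x (int s + 2) = ?P (int s + 2)"
    "pos x (int s) = ?P (int s + 1)"
    by (simp_all add: s2)
  have "pos x (int s + 2) < pos x (int s + 1)"
    using P1 P2 x1 by linarith
  then have "pos x (int s + 2 + k * int n) < pos x (int s + 1 + k * int n)"
    by (simp only: pos_shift add_less_cancel_right)
  moreover have "int s + 2 + k * int n = int t + 1"
    using k by simp
  ultimately have "pos x (int t + 1) < pos x (int t)"
    by (simp only: k[symmetric])
  then obtain x' where x': "reduced_list (t # x')" "pos (t # x') = pos x"
    "length (t # x') = length x"
    using descent_first[OF reduced_list_ConsD[OF x] letters(2)] by blast
  have x'_eq: "pos x' w = pos x (sr t w)" for w
    using fun_cong[OF x'(2), of "sr t w"] by simp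
  have "sr t (int s + 1) = int s + 2" "sr t (int s) = int s"
    using t neq by (simp_all add: sr_up sr_fix)
  then have "pos x' (int s + 1) < pos x' (int s)"
    using P2 by (simp only: x'_eq x1)
  then obtain z where z: "reduced_list (s # z)" "pos (s # z) = pos x'" "length (s # z) = length x'"
    using descent_first[OF reduced_list_ConsD[OF x'(1)] letters(1)] by blast
  have tsz: "pos (t # s # z) = pos x"
    using pos_Cons_cong[OF z(2), of t] x'(2) by simp
  have lx: "length x = length z + 2"
    using z(3) x'(3) by simp
  have lz: "set z \<subseteq> {..<n}"
    using reduced_list_letters[OF z(1)] by simp
  have r1: "reduced_list (t # s # z)"
    using reduced_list_cong[OF reduced_list_ConsD[OF x], of "t # s # z"] letters lz tsz lx by simp
  have "pos (t # y) = pos ([s, t, s] @ z)"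
    using eq pos_Cons_cong[OF tsz, of s] by simp
  also have "\<dots> = pos ([t, s, t] @ z)"
    by (intro pos_append_cong pos_braid n t refl)
  finally have stz: "pos (s # t # z) = pos y"
    by (metis append_Cons append_Nil pos_Cons_cancel)
  have "length x = length y"
    using reduced_list_length_eq[OF x y eq] by simp
  then have "reduced_list (s # t # z)"
    using reduced_list_cong[OF reduced_list_ConsD[OF y], of "s # t # z"] letters lz stz lx by simp
  then show ?thesis
    using that n r1 tsz stz by blast
qed

text \<open>The reflection s fixes t and t + 1, so the descent at t survives the removal of the
  first letter s.\<close>

lemma dihedral_commuting:
  assumes x: "reduced_list (s # x)" and y: "reduced_list (t # y)"
      and eq: "pos (s # x) = pos (t # y)"
    and st: "int s mod int n \<noteq> int t mod int n"
      "int s mod int n \<noteq> (int t + 1) mod int n" "int t mod int n \<noteq> (int s + 1) mod int n"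
  obtains z where "reduced_list (t # z)" "pos (t # z) = pos x" "reduced_list (s # z)"
    "pos (s # z) = pos y"
proof -
  have st1: "(int s + 1) mod int n \<noteq> (int t + 1) mod int n"
    using st(1) mod_Suc_cancel by blast
  have fix_t: "sr s (int t) = int t" "sr s (int t + 1) = int t + 1"
    using st st1 by (simp_all add: sr_fix)
  have fix_s: "sr t (int s) = int s" "sr t (int s + 1) = int s + 1"
    using st st1 by (simp_all add: sr_fix)
  have letters: "s < n" "t < n"
    using reduced_list_letters[OF x] reduced_list_letters[OF y] by auto
  have "pos (t # y) (int t + 1) < pos (t # y) (int t)"
    using reduced_list_ascent[OF y] by simp
  then have "pos x (int t + 1) < pos x (int t)"
    unfolding eq[symmetric] using fix_t by simp
  then obtain z where z: "reduced_list (t # z)" "pos (t # z) = pos x" "length (t # z) = length x"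
    using descent_first[OF reduced_list_ConsD[OF x] letters(2)] by blast
  have "pos (t # y) = pos ([s, t] @ z)"
    using eq pos_Cons_cong[OF z(2), of s] by simp
  also have "\<dots> = pos ([t, s] @ z)"
    using pos_commute[of "[t]" s s] fix_s by (intro pos_append_cong) auto
  finally have sz: "pos (s # z) = pos y"
    by (metis append_Cons append_Nil pos_Cons_cancel)
  have "length x = length y"
    using reduced_list_length_eq[OF x y eq] by simp
  then have "reduced_list (s # z)"
    using reduced_list_cong[OF reduced_list_ConsD[OF y],
        of "s # z"] letters reduced_list_letters[OF z(1)] sz z(3) by simp
  then show ?thesis
    using that z sz by blast
qed

text \<open>Matsumoto's theorem, proved directly for matrices by induction on the length: two
  reduced words with different first letters are joined through words that begin with the two sides
  of a rank two relation.\<close>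

lemma same_matrices_if_reduced: "reduced_list u \<Longrightarrow> reduced_list v \<Longrightarrow> pos u = pos v
    \<Longrightarrow> same_matrices u v"
proof (induction "length u" arbitrary: u v rule: less_induct)
  case less
  have len: "length u = length v"
    using less.prems by (rule reduced_list_length_eq)
  show ?case
  proof (cases u)
    case Nil
    then show ?thesis using len by (simp add: same_matrices_refl)
  next
    case (Cons s x)
    then obtain t y where v: "v = t # y"
      using len by (cases v) auto
    note uv = Cons v
    have reduced_list: "reduced_list (s # x)"
      "reduced_list (t # y)" and eq: "pos (s # x) = pos (t # y)"
      using less.prems uv by auto
    have IH: "same_matrices x' y'" if "reduced_list x'" "reduced_list y'" "pos x' = pos y'"
      "length x' < length u" for x' y'
      using less.hyps that by blast
    have lx: "length x < length u" and ly: "length y < length u"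
      using uv len by auto
    have letters: "s < n" "t < n"
      using reduced_list_letters reduced_list by fastforce+
    \<comment> \<open>Below the first letter the induction hypothesis applies, so only the relation
      at the front remains to be supplied.\<close>
    have step: "same_matrices (s # x) (t # y)"
      if "reduced_list w" "pos w = pos x" "reduced_list w'" "pos w' = pos y"
        "same_matrices (s # w) (t # w')" for w w'
    proof -
      have "same_matrices x w"
        using IH that lx reduced_list by (metis reduced_list_ConsD)
      moreover have "same_matrices w' y"
        using IH that ly reduced_list by (metis reduced_list_ConsD reduced_list_length_eq)
      ultimately show ?thesis
        using same_matrices_Cons same_matrices_trans that(5) by blast
    qed
    consider "s = t" | "int t mod int n = (int s + 1) mod int n"
        | "int s mod int n = (int t + 1) mod int n"
      | "int s mod int n \<noteq> int t mod int n"
        "int s mod int n \<noteq> (int t + 1) mod int n" "int t mod int n \<noteq> (int s + 1) mod int n"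
      using letters by (cases "s = t") auto
    then have "same_matrices (s # x) (t # y)"
    proof cases
      case 1
      then have "same_matrices x y"
        using IH lx reduced_list eq pos_Cons_cancel reduced_list_ConsD by blast
      then show ?thesis
        using 1 same_matrices_Cons by simp
    next
      case 2
      then obtain z where "2 < n" "reduced_list (t # s # z)" "pos (t # s # z) = pos x"
        "reduced_list (s # t # z)" "pos (s # t # z) = pos y"
        using dihedral_adjacent[OF reduced_list eq] by metis
      then show ?thesis
        using step same_matrices_braid 2 by blast
    next
      case 3
      then obtain z where "2 < n" "reduced_list (s # t # z)" "pos (s # t # z) = pos y"
        "reduced_list (t # s # z)" "pos (t # s # z) = pos x"
        using dihedral_adjacent[OF reduced_list(2,1) eq[symmetric]] by metis
      then show ?thesis
        using step same_matrices_braid 3 by blast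
    next
      case 4
      then obtain z where "reduced_list (t # z)" "pos (t # z) = pos x" "reduced_list (s # z)"
        "pos (s # z) = pos y"
        using dihedral_commuting[OF reduced_list eq] by metis
      then show ?thesis
        using step same_matrices_commute[OF 4(2,3)] by blast
    qed
    then show ?thesis
      using uv by simp
  qed
qed

subsection \<open>Uniqueness of parameters\<close>

text \<open>Infinitely many rows lie above row r; generating the span inductively restricts it to
  finite combinations without naming their supports.\<close>

inductive_set rowspan :: "unfolded \<Rightarrow> int \<Rightarrow> (int \<Rightarrow> real) set" for M r where
  zero: "(\<lambda>_. 0) \<in> rowspan M r"
| step: "f \<in> rowspan M r \<Longrightarrow> r' \<le> r \<Longrightarrow> (\<lambda>c. f c + k * M r' c) \<in> rowspan M r"

lemma rowspan_add:
  assumes "g \<in> rowspan M r" "f \<in> rowspan M r"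
  shows "(\<lambda>c. f c + g c) \<in> rowspan M r"
  using assms(1)
proof (induction rule: rowspan.induct)
  case zero
  then show ?case using assms(2) by simp
next
  case (step g r' k)
  have "(\<lambda>c. (f c + g c) + k * M r' c) \<in> rowspan M r"
    by (rule rowspan.step[OF step.IH step.hyps(2)])
  then show ?case
    by (simp only: add.assoc)
qed

lemma rowspan_scale:
  assumes "f \<in> rowspan M r"
  shows "(\<lambda>c. k * f c) \<in> rowspan M r"
  using assms
proof (induction rule: rowspan.induct)
  case zero
  then show ?case using rowspan.zero by simp
next
  case (step f r' k')
  have "(\<lambda>c. k * f c + (k * k') * M r' c) \<in> rowspan M r"
    by (rule rowspan.step[OF step.IH step.hyps(2)])
  then show ?case
    by (simp only: distrib_left mult.assoc)
qed

lemma rowspan_row: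
  assumes "r' \<le> r"
  shows "M r' \<in> rowspan M r"
proof -
  have "(\<lambda>c. 0 + 1 * M r' c) \<in> rowspan M r"
    by (rule rowspan.step[OF rowspan.zero assms])
  then show ?thesis by simp
qed

lemma rowspan_mono:
  assumes "f \<in> rowspan M r" "r \<le> r'"
  shows "f \<in> rowspan M r'"
  using assms(1)
proof (induction rule: rowspan.induct)
  case zero
  show ?case by (rule rowspan.zero)
next
  case (step f r'' k)
  show ?case
    by (rule rowspan.step[OF step.IH]) (use step.hyps assms in simp)
qed

lemma rowspan_split:
  assumes "f \<in> rowspan M r"
  shows "\<exists>g k. g \<in> rowspan M (r - 1) \<and> f = (\<lambda>c. g c + k * M r c)"
  using assms
proof (induction rule: rowspan.induct)
  case zero
  have "(\<lambda>_. 0) = (\<lambda>c. 0 + 0 * M r c)"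
    by simp
  then show ?case
    using rowspan.zero by metis
next
  case (step f r' k)
  then obtain g k' where g: "g \<in> rowspan M (r - 1)" "f = (\<lambda>c. g c + k' * M r c)"
    by blast
  show ?case
  proof (cases "r' = r")
    case True
    have "(\<lambda>c. f c + k * M r' c) = (\<lambda>c. g c + (k' + k) * M r c)"
      unfolding g(2) True by (simp only: distrib_right add.assoc)
    then show ?thesis
      using g(1) by blast
  next
    case False
    then have "(\<lambda>c. g c + k * M r' c) \<in> rowspan M (r - 1)"
      using step.hyps(2) by (intro rowspan.step[OF g(1)]) simp
    moreover have "(\<lambda>c. f c + k * M r' c) = (\<lambda>c. (g c + k * M r' c) + k' * M r c)"
      unfolding g(2) by (rule ext) simp
    ultimately show ?thesis
      by blast
  qed
qed

lemma rowspan_subset: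
  assumes "\<And>r'. r' \<le> r \<Longrightarrow> M' r' \<in> rowspan M r"
  shows "rowspan M' r \<subseteq> rowspan M r"
proof
  fix f assume "f \<in> rowspan M' r"
  then show "f \<in> rowspan M r"
  proof (induction rule: rowspan.induct)
    case zero
    show ?case by (rule rowspan.zero)
  next
    case (step f r' k)
    show ?case
      by (rule rowspan_add[OF rowspan_scale[OF assms[OF step.hyps(2)]] step.IH])
  qed
qed

text \<open>The operation adds multiples of rows r' + 1 to rows r' congruent to s. It leads out of
  the block of rows up to r only for r' = r, which the hypothesis on r excludes.\<close>

lemma rowspan_lmul_subset:
  assumes "r mod int n \<noteq> int s mod int n"
  shows "rowspan (lmul s a M) r \<subseteq> rowspan M r"
proof (rule rowspan_subset)
  fix r' assume r': "r' \<le> r"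
  show "lmul s a M r' \<in> rowspan M r"
  proof (cases "r' mod int n = int s mod int n")
    case True
    then have "r' + 1 \<le> r"
      using r' assms by (cases "r' = r") auto
    then have "(\<lambda>c. M r' c + a * M (r' + 1) c) \<in> rowspan M r"
      using rowspan.step[OF rowspan_row[OF r'], of "r' + 1" M a] by simp
    moreover have "lmul s a M r' = (\<lambda>c. M r' c + a * M (r' + 1) c)"
      using True by (auto simp: lmul_def)
    ultimately show ?thesis by simp
  next
    case False
    then have "lmul s a M r' = M r'"
      by (auto simp: lmul_def)
    then show ?thesis
      using rowspan_row r' by simp
  qed
qed

lemma lmul_inverse: "lmul s (- a) (lmul s a M) = M"
  by (simp add: lmul_lmul lmul_0)

lemma rowspan_lmul:
  assumes "r mod int n \<noteq> int s mod int n"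
  shows "rowspan (lmul s a M) r = rowspan M r"
  using rowspan_lmul_subset[OF assms, of a M] rowspan_lmul_subset[OF assms, of "- a" "lmul s a M"]
  by (simp add: lmul_inverse)

definition top_at :: "(int \<Rightarrow> real) \<Rightarrow> int \<Rightarrow> bool" where
  "top_at f p \<longleftrightarrow> f p \<noteq> 0 \<and> (\<forall>c>p. f c = 0)"

text \<open>
  \<open>jumps M q\<close>: modulo the rows above it, row \<open>r\<close> of \<open>M\<close> can be reduced to end in column \<open>q r\<close>
  and no further to the left. This determines \<open>q\<close>, the Bruhat cell of \<open>M\<close>.
\<close>

definition jumps :: "unfolded \<Rightarrow> (int \<Rightarrow> int) \<Rightarrow> bool" where
  "jumps M q \<longleftrightarrow> (\<forall>r.
     (\<exists>f\<in>rowspan M (r - 1). top_at (\<lambda>c. M r c + f c) (q r)) \<and>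
     (\<forall>f\<in>rowspan M (r - 1). \<exists>c\<ge>q r. M r c + f c \<noteq> 0))"

lemma jumps_le:
  assumes "jumps M q" "jumps M q'"
  shows "q' r \<le> q r"
proof -
  obtain f where f: "f \<in> rowspan M (r - 1)" "top_at (\<lambda>c. M r c + f c) (q r)"
    using assms(1) unfolding jumps_def by blast
  obtain c where "c \<ge> q' r" "M r c + f c \<noteq> 0"
    using assms(2) f(1) unfolding jumps_def by blast
  then show ?thesis
    using f(2) unfolding top_at_def by (metis linorder_not_less order_trans)
qed

lemma jumps_unique: "jumps M q \<Longrightarrow> jumps M q' \<Longrightarrow> q = q'"
  by (intro ext antisym) (auto intro: jumps_le)

lemma jumps_one: "jumps unfolded_one (\<lambda>r. r)"
  unfolding jumps_def
proof (intro allI conjI ballI)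
  fix r
  have "top_at (\<lambda>c. unfolded_one r c + 0) r"
    by (simp add: top_at_def unfolded_one_def)
  then show "\<exists>f\<in>rowspan unfolded_one (r - 1). top_at (\<lambda>c. unfolded_one r c + f c) r"
    by (rule bexI[OF _ rowspan.zero])
  fix f assume "f \<in> rowspan unfolded_one (r - 1)"
  then have "f r = 0"
    by (induction rule: rowspan.induct) (simp_all add: unfolded_one_def)
  then have "unfolded_one r r + f r \<noteq> 0"
    by (simp add: unfolded_one_def)
  then show "\<exists>c\<ge>r. unfolded_one r c + f c \<noteq> 0"
    by blast
qed

lemma top_at_scale: "top_at f p \<Longrightarrow> k \<noteq> 0 \<Longrightarrow> top_at (\<lambda>c. k * f c) p"
  by (simp add: top_at_def)

lemma top_at_add: "top_at f p \<Longrightarrow> top_at g q \<Longrightarrow> q < p \<Longrightarrow> top_at (\<lambda>c. f c + k * g c) p"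
  by (simp add: top_at_def)

text \<open>The spans of the rows up to r change only for r congruent to s, so only the jumps of
  such r and r + 1 are affected. As q r < q (r + 1), the added multiple of row r + 1 dominates row
  r, and the two jumps trade places. The sign of \<open>a\<close> is left open because
  \<open>word_matrix_unique\<close> takes a difference of parameters for it.\<close>

lemma jumps_lmul:
  assumes q: "jumps M q" and a: "a \<noteq> 0"
    and asc: "\<And>r. r mod int n = int s mod int n \<Longrightarrow> q r < q (r + 1)"
  shows "jumps (lmul s a M) (\<lambda>r. q (sr s r))"
  unfolding jumps_def
proof
  fix r
  let ?M = "lmul s a M"
  have ex: "\<exists>f\<in>rowspan M (r - 1). top_at (\<lambda>c. M r c + f c) (q r)" for r
    using q unfolding jumps_def by blast
  have lb: "\<exists>c\<ge>q r. M r c + f c \<noteq> 0" if "f \<in> rowspan M (r - 1)" for r f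
    using q that unfolding jumps_def by blast
  let ?goal = "\<lambda>r p. (\<exists>f\<in>rowspan ?M (r - 1). top_at (\<lambda>c. ?M r c + f c) p) \<and>
      (\<forall>f\<in>rowspan ?M (r - 1). \<exists>c\<ge>p. ?M r c + f c \<noteq> 0)"
  have below: "rowspan ?M (r - 1) = rowspan M (r - 1)" if "r mod int n = int s mod int n" for r
    using that mod_Suc_neq[of "r - 1"] by (intro rowspan_lmul) auto
  have up: "?goal r (q (r + 1))" if r: "r mod int n = int s mod int n" for r
  proof
    have Mr: "?M r = (\<lambda>c. M r c + a * M (r + 1) c)"
      using r by (auto simp: lmul_def)
    obtain f where f: "f \<in> rowspan M r" "top_at (\<lambda>c. M (r + 1) c + f c) (q (r + 1))"
      using ex[of "r + 1"] by auto
    obtain g k where g: "g \<in> rowspan M (r - 1)" "f = (\<lambda>c. g c + k * M r c)"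
      using rowspan_split[OF f(1)] by blast
    obtain f0 where f0: "f0 \<in> rowspan M (r - 1)" "top_at (\<lambda>c. M r c + f0 c) (q r)"
      using ex by blast
    \<comment> \<open>The coefficient 1 - a * k brings the total weight of row r to one, since
      \<open>f\<close> already contributes a * k of it.\<close>
    define h where "h = (\<lambda>c. a * g c + (1 - a * k) * f0 c)"
    have "h \<in> rowspan M (r - 1)"
      unfolding h_def by (intro rowspan_add rowspan_scale g f0)
    moreover have "top_at (\<lambda>c. a * (M (r + 1) c + f c) + (1 - a * k) * (M r c + f0 c)) (q (r + 1))"
      using f f0 a asc[OF r] by (intro top_at_add top_at_scale)
    moreover have "(\<lambda>c. a * (M (r + 1) c + f c) + (1 - a * k) * (M r c + f0 c)) =
        (\<lambda>c. ?M r c + h c)"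
      by (simp add: Mr h_def g(2) algebra_simps)
    ultimately show "\<exists>f\<in>rowspan ?M (r - 1). top_at (\<lambda>c. ?M r c + f c) (q (r + 1))"
      unfolding below[OF r] by auto
    show "\<forall>f\<in>rowspan ?M (r - 1). \<exists>c\<ge>q (r + 1). ?M r c + f c \<noteq> 0"
    proof
      fix f assume "f \<in> rowspan ?M (r - 1)"
      then have "f \<in> rowspan M r"
        using below[OF r] rowspan_mono[of f M "r - 1" r] by simp
      then have "(\<lambda>c. (1 / a) * (M r c + f c)) \<in> rowspan M r"
        by (intro rowspan_scale rowspan_add rowspan_row) auto
      then obtain c where c: "c \<ge> q (r + 1)" "M (r + 1) c + (1 / a) * (M r c + f c) \<noteq> 0"
        using lb[of _ "r + 1"] by force
      have "?M r c + f c = a * (M (r + 1) c + (1 / a) * (M r c + f c))"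
        using a by (simp add: Mr distrib_left)
      then show "\<exists>c\<ge>q (r + 1). ?M r c + f c \<noteq> 0"
        using c a by (metis mult_eq_0_iff)
    qed
  qed
  have down: "?goal (r + 1) (q r)" if r: "r mod int n = int s mod int n" for r
  proof
    have Mr: "?M r = (\<lambda>c. M r c + a * M (r + 1) c)"
      using r by (auto simp: lmul_def)
    have Mr1: "?M (r + 1) = M (r + 1)"
      using r mod_Suc_neq[of r] by (auto simp: lmul_def)
    obtain f0 where f0: "f0 \<in> rowspan M (r - 1)" "top_at (\<lambda>c. M r c + f0 c) (q r)"
      using ex by blast
    have "f0 \<in> rowspan ?M r"
      using f0(1) below[OF r] rowspan_mono[of f0 ?M "r - 1" r] by simp
    \<comment> \<open>Modulo the new row r, row r + 1 is -1 / a times the old row r, which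
      \<open>f0\<close> reduces to column q r.\<close>
    then have "(\<lambda>c. (- 1 / a) * (f0 c + ?M r c)) \<in> rowspan ?M r"
      by (intro rowspan_scale rowspan_add rowspan_row) auto
    moreover have "top_at (\<lambda>c. (- 1 / a) * (M r c + f0 c)) (q r)"
      using f0(2) a by (intro top_at_scale) auto
    moreover have "(\<lambda>c. (- 1 / a) * (M r c + f0 c)) =
        (\<lambda>c. ?M (r + 1) c + (- 1 / a) * (f0 c + ?M r c))"
      unfolding Mr Mr1 using a by (simp add: fun_eq_iff field_simps)
    ultimately show "\<exists>f\<in>rowspan ?M (r + 1 - 1). top_at (\<lambda>c. ?M (r + 1) c + f c) (q r)"
      unfolding add_diff_cancel_right'
        by (intro bexI[where x = "\<lambda>c. (- 1 / a) * (f0 c + ?M r c)"]) simp_all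
    show "\<forall>f\<in>rowspan ?M (r + 1 - 1). \<exists>c\<ge>q r. ?M (r + 1) c + f c \<noteq> 0"
    proof
      fix f assume "f \<in> rowspan ?M (r + 1 - 1)"
      then have "f \<in> rowspan ?M r" by simp
      then obtain g k where g: "g \<in> rowspan ?M (r - 1)" "f = (\<lambda>c. g c + k * ?M r c)"
        using rowspan_split by blast
      have g': "g \<in> rowspan M (r - 1)"
        using g(1) below[OF r] by simp
      show "\<exists>c\<ge>q r. ?M (r + 1) c + f c \<noteq> 0"
      \<comment> \<open>This number is the weight of row r + 1 in the combination. If it vanishes,
        row r with weight k and the rows above it remain; otherwise the combination reaches column q
        (r + 1).\<close>
      proof (cases "1 + k * a = 0")
        case True
        then have k: "k \<noteq> 0" by auto
        have "(\<lambda>c. (1 / k) * g c) \<in> rowspan M (r - 1)"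
          using g' by (rule rowspan_scale)
        then obtain c where c: "c \<ge> q r" "M r c + (1 / k) * g c \<noteq> 0"
          using lb by blast
        have "?M (r + 1) c + f c = (1 + k * a) * M (r + 1) c + (k * M r c + g c)"
          by (simp only: Mr Mr1 g(2)) (simp add: algebra_simps)
        also have "\<dots> = k * (M r c + (1 / k) * g c)"
          using True k by (simp add: distrib_left)
        finally show ?thesis
          using c k by (metis mult_eq_0_iff)
      next
        case False
        have "(\<lambda>c. (1 / (1 + k * a)) * (g c + k * M r c)) \<in> rowspan M r"
          using g' by (intro rowspan_scale rowspan.step rowspan_mono[of g M "r - 1" r]) auto
        then obtain c where c: "c \<ge> q (r + 1)"
          "M (r + 1) c + (1 / (1 + k * a)) * (g c + k * M r c) \<noteq> 0"
          using lb[of _ "r + 1"] by force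
        have "?M (r + 1) c + f c = (1 + k * a) * M (r + 1) c + (g c + k * M r c)"
          by (simp only: Mr Mr1 g(2)) (simp add: algebra_simps)
        also have "\<dots> = (1 + k * a) * (M (r + 1) c + (1 / (1 + k * a)) * (g c + k * M r c))"
          using False by (simp add: distrib_left)
        finally have "?M (r + 1) c + f c \<noteq> 0"
          using c False by (metis mult_eq_0_iff)
        moreover have "c \<ge> q r"
          using c(1) asc[OF r] by linarith
        ultimately show ?thesis by blast
      qed
    qed
  qed
  consider "r mod int n = int s mod int n" | "r mod int n = (int s + 1) mod int n"
    | "r mod int n \<noteq> int s mod int n" "r mod int n \<noteq> (int s + 1) mod int n"
    by blast
  then show "?goal r (q (sr s r))"
  proof cases
    case 1
    then show ?thesis using up by (simp add: sr_up)
  next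
    case 2
    then show ?thesis
      using down[of "r - 1"] mod_pred[of r "int s"] by (simp add: sr_down)
  next
    case 3
    then have "?M r = M r" "sr s r = r"
      by (auto simp: lmul_def sr_fix)
    moreover have "rowspan ?M (r - 1) = rowspan M (r - 1)"
      using 3(2) mod_Suc_cong[of "r - 1" "int s"] by (intro rowspan_lmul) auto
    ultimately show ?thesis
      using ex[of r] lb[of _ r] by simp
  qed
qed

lemma reduced_list_ascent_mod:
  assumes "reduced_list (s # u)" "r mod int n = int s mod int n"
  shows "pos u r < pos u (r + 1)"
proof -
  obtain k where k: "r = int s + k * int n"
    using assms(2) by (rule mod_eqD)
  have "pos u (r + 1) = pos u (int s + 1) + k * int n"
    using pos_shift[of u "int s + 1" k] by (simp add: k algebra_simps)
  then show ?thesis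
    using reduced_list_ascent[OF assms(1)] by (simp add: k pos_shift)
qed

lemma jumps_word_matrix: "reduced_list (map fst ps) \<Longrightarrow> positive ps
    \<Longrightarrow> jumps (word_matrix ps) (pos (map fst ps))"
proof (induction ps)
  case Nil
  have "pos [] = (\<lambda>r. r)"
    by (rule ext) simp
  then show ?case
    using jumps_one by simp
next
  case (Cons p ps)
  obtain s a where p: "p = (s, a)" by force
  have reduced_list: "reduced_list (s # map fst ps)"
    using Cons.prems p by simp
  have "jumps (word_matrix ps) (pos (map fst ps))"
    using Cons reduced_list reduced_list_ConsD by simp
  then have "jumps (lmul s a (word_matrix ps)) (\<lambda>r. pos (map fst ps) (sr s r))"
    using reduced_list_ascent_mod[OF reduced_list] Cons.prems p by (intro jumps_lmul) auto
  moreover have "(\<lambda>r. pos (map fst ps) (sr s r)) = pos (map fst (p # ps))"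
    by (rule ext) (simp add: p)
  ultimately show ?case
    by (simp only: p word_matrix_Cons)
qed

text \<open>If the first parameters a and b differed, stripping them off would give two matrices
  related by \<open>lmul\<close> with the nonzero parameter a - b. By \<open>jumps_lmul\<close> this
  moves the second matrix to another Bruhat cell, while positivity puts both into the same one. The
  remainders may be spelled differently; only their permutations have to agree.\<close>

lemma word_matrix_unique:
  assumes "map fst ps = map fst ps'" "positive ps" "positive ps'" "positive qs" "positive qs'"
    and "reduced_list (map fst ps @ map fst qs)" "reduced_list (map fst ps' @ map fst qs')"
    and "pos (map fst qs) = pos (map fst qs')" and "word_matrix (ps @ qs) = word_matrix (ps' @ qs')"
  shows "ps = ps'"
  using assms
proof (induction ps arbitrary: ps')
  case Nil
  then show ?case by simp
next
  case (Cons p ps)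
  obtain s a where p: "p = (s, a)" by force
  obtain b ps1 where ps': "ps' = (s, b) # ps1" "map fst ps1 = map fst ps"
    using Cons.prems(1) p by (cases ps') auto
  let ?u = "map fst (ps @ qs)" and ?u' = "map fst (ps1 @ qs')"
  let ?M = "word_matrix (ps @ qs)" and ?M' = "word_matrix (ps1 @ qs')"
  have rds: "reduced_list (s # ?u)" "reduced_list (s # ?u')"
    using Cons.prems(6,7) p ps' by auto
  have positive: "positive (ps @ qs)" "positive (ps1 @ qs')"
    using Cons.prems(2-5) p ps' by auto
  have eq: "pos ?u = pos ?u'"
    using Cons.prems(8) unfolding map_append ps'(2) by (rule pos_append_cong[OF refl])
  have jumps: "jumps ?M (pos ?u)" "jumps ?M' (pos ?u)"
    using jumps_word_matrix[OF reduced_list_ConsD[OF rds(1)]] jumps_word_matrix[OF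
        reduced_list_ConsD[OF rds(2)]] positive
    unfolding eq by blast+
  have mult_word: "lmul s a ?M = lmul s b ?M'"
    using Cons.prems(9) by (simp only: p ps' append_Cons word_matrix_Cons)
  have "lmul s (- b + a) ?M = lmul s (- b) (lmul s a ?M)"
    by (simp only: lmul_lmul)
  then have M': "lmul s (- b + a) ?M = ?M'"
    unfolding mult_word lmul_inverse .
  have ab: "a = b"
  proof (rule ccontr)
    assume "a \<noteq> b"
    then have "jumps ?M' (\<lambda>r. pos ?u (sr s r))"
      unfolding M'[symmetric] using jumps(1) reduced_list_ascent_mod[OF rds(1)]
        by (intro jumps_lmul) auto
    then have "pos ?u = (\<lambda>r. pos ?u (sr s r))"
      using jumps(2) jumps_unique by blast
    from fun_cong[OF this, of "int s"] show False
      unfolding pos_inj by simp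
  qed
  then have "?M = ?M'"
    using M' unfolding ab by (simp only: left_minus lmul_0)
  then have "ps = ps1"
    using ps'(2) positive reduced_list_ConsD[OF rds(1)] reduced_list_ConsD[OF rds(2)] Cons.prems(8)
    by (intro Cons.IH) auto
  then show ?case
    using p ps' ab by simp
qed

subsection \<open>Transport along braid moves\<close>

definition prefix_pairs :: "word \<Rightarrow> params \<Rightarrow> nat \<Rightarrow> (nat \<times> real) list" where
  "prefix_pairs w a M = map (\<lambda>k. (w k, a k)) [0..<M]"

lemma prefix_pairs_Suc: "prefix_pairs w a (Suc M) = prefix_pairs w a M @ [(w M, a M)]"
  by (simp add: prefix_pairs_def)

lemma map_fst_prefix_pairs: "map fst (prefix_pairs w a M) = map w [0..<M]"
  by (simp add: prefix_pairs_def)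

lemma length_pr [simp]: "length (prefix_pairs w a M) = M"
  by (simp add: prefix_pairs_def)

lemma upt_split: "i \<le> m \<Longrightarrow> m \<le> M \<Longrightarrow> [i..<M] = [i..<m] @ [m..<M]"
  using upt_add_eq_append[of i m "M - m"] by simp

lemma prefix_pairs_split: "m \<le> M
    \<Longrightarrow> prefix_pairs w a M = prefix_pairs w a m @ map (\<lambda>k. (w k, a k)) [m..<M]"
  by (simp add: prefix_pairs_def upt_split[of 0 m M])

lemma mass_prefix_pairs: "mass (prefix_pairs w a M) = (\<Sum>k<M. a k)"
  by (induction M) (simp_all add: prefix_pairs_Suc, simp add: prefix_pairs_def)

definition admissible :: "word \<times> params \<Rightarrow> bool" where
  "admissible x \<longleftrightarrow> (\<forall>k. fst x k < n \<and> 0 < snd x k)"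

lemma positive_prefix_pairs: "admissible (w, a) \<Longrightarrow> positive (prefix_pairs w a M)"
  by (auto simp: admissible_def positive_def prefix_pairs_def)

text \<open>Column c of a generator vanishes outside rows c - 1 and c, which reduces the infinite
  sum to the two terms of \<open>rmul\<close>.\<close>

lemma unfolded_mult_chevalley:
  assumes "i < n"
  shows "unfolded_mult X (chevalley n i a) = rmul i a X"
proof (intro ext)
  fix r c
  have ex: "(\<exists>j. x = j * int n + int i \<and> y = j * int n + int i + 1)
      \<longleftrightarrow> x mod int n = int i mod int n \<and> y = x + 1" for x y
  proof
    assume "x mod int n = int i mod int n \<and> y = x + 1"
    moreover from this obtain k where "x = int i + k * int n"
      by (meson mod_eqD)
    ultimately show "\<exists>j. x = j * int n + int i \<and> y = j * int n + int i + 1"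
      by (intro exI[of _ k]) simp
  qed auto
  have chev: "chevalley n i a x y =
      (if x mod int n = int i mod int n \<and> y = x + 1 then a else if x = y then 1 else 0)" for x y
    unfolding chevalley_def ex unfolded_one_def ..
  have "unfolded_mult X (chevalley n i a) r c = (\<Sum>\<^sub>\<infinity>k\<in>{c - 1, c}. X r k * chevalley n i a k c)"
    unfolding unfolded_mult_def by (intro infsum_cong_neutral) (auto simp: chev)
  also have "\<dots> = (\<Sum>k\<in>{c - 1, c}. X r k * chevalley n i a k c)"
    by (rule infsum_finite) simp
  also have "\<dots> = rmul i a X r c"
    by (simp add: chev rmul_def)
  finally show "unfolded_mult X (chevalley n i a) r c = rmul i a X r c" .
qed

lemma chevalley_prefix_eq:
  assumes "\<And>k. w k < n"
  shows "chevalley_prefix n w a M = word_matrix (prefix_pairs w a M)"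
  by (induction M) (simp_all add: prefix_pairs_Suc mult_word_append unfolded_mult_chevalley assms,
      simp add: prefix_pairs_def)

text \<open>The invariant of transport: finitely many moves change finitely many places, and
  prefixes reaching beyond these have the same product and the same permutation.\<close>

definition eventually_agree :: "word \<times> params \<Rightarrow> word \<times> params \<Rightarrow> bool" where
  "eventually_agree x y \<longleftrightarrow> (\<exists>M0. \<forall>M\<ge>M0. word_matrix (prefix_pairs (fst x) (snd x) M) =
      word_matrix (prefix_pairs (fst y) (snd y) M) \<and>
     pos (map (fst x) [0..<M]) = pos (map (fst y) [0..<M]))"

lemma eventually_agreeE:
  assumes "eventually_agree (w, a) (w', a')"
  obtains M0 where "\<And>M. M0 \<le> M
      \<Longrightarrow> word_matrix (prefix_pairs w a M) = word_matrix (prefix_pairs w' a' M)"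
    "\<And>M. M0 \<le> M \<Longrightarrow> pos (map w [0..<M]) = pos (map w' [0..<M])"
  using assms unfolding eventually_agree_def fst_conv snd_conv by metis

lemma eventually_agree_refl: "eventually_agree x x"
  by (auto simp: eventually_agree_def)

lemma eventually_agree_sym: "eventually_agree x y \<Longrightarrow> eventually_agree y x"
  unfolding eventually_agree_def by metis

lemma eventually_agree_trans:
  assumes "eventually_agree x y" "eventually_agree y z"
  shows "eventually_agree x z"
proof -
  obtain M0 M1 where
    "\<forall>M\<ge>M0. word_matrix (prefix_pairs (fst x) (snd x) M) =
        word_matrix (prefix_pairs (fst y) (snd y) M) \<and>
       pos (map (fst x) [0..<M]) = pos (map (fst y) [0..<M])"
    "\<forall>M\<ge>M1. word_matrix (prefix_pairs (fst y) (snd y) M) =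
        word_matrix (prefix_pairs (fst z) (snd z) M) \<and>
       pos (map (fst y) [0..<M]) = pos (map (fst z) [0..<M])"
    using assms unfolding eventually_agree_def by blast
  then show ?thesis
    unfolding eventually_agree_def by (intro exI[of _ "max M0 M1"]) simp
qed

text \<open>A commutation move may swap two equal letters, hence the first alternative. Neighbours
  never commute, not even for n = 2: one order moves the value s by two to the right, the other by
  at most one.\<close>

lemma refl_commute_cases:
  assumes "refl_commute n s t" "s < n" "t < n"
  shows "s = t \<or> int s mod int n \<noteq> (int t + 1) mod int n \<and> int t mod int n \<noteq> (int s + 1) mod int n"
proof -
  have no: False if "sr s \<circ> sr t = sr t \<circ> sr s"
      and t: "int t mod int n = (int s + 1) mod int n" for s t
  proof -
    have st: "int s mod int n \<noteq> int t mod int n"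
      using t mod_Suc_neq by metis
    have "sr t (sr s (int s)) = int s + 2"
      using t by (simp add: sr_up)
    moreover have "sr t (int s) \<le> int s"
      using st by (simp add: simple_refl_def)
    moreover have "sr s (sr t (int s)) \<le> sr t (int s) + 1"
      by (simp add: simple_refl_def)
    ultimately show False
      using fun_cong[OF that(1), of "int s"] by simp
  qed
  show ?thesis
    using no[of s t] no[of t s] assms(1) unfolding refl_commute_def by metis
qed

lemma eventually_agree_local:
  assumes m: "length xs = length ys"
    and eqs: "\<And>X. mult_word X xs = mult_word X ys" "pos (map fst xs) = pos (map fst ys)"
    and xs: "\<And>k. k < length xs \<Longrightarrow> xs ! k = (w (p + k), a (p + k))"
    and ys: "\<And>k. k < length xs \<Longrightarrow> ys ! k = (w' (p + k), a' (p + k))"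
    and out: "\<And>k. k < p \<or> k \<ge> p + length xs \<Longrightarrow> w' k = w k \<and> a' k = a k"
  shows "eventually_agree (w, a) (w', a')"
  unfolding eventually_agree_def
proof (intro exI[of _ "p + length xs"] allI impI)
  fix M assume M: "p + length xs \<le> M"
  let ?z = "map (\<lambda>k. (w k, a k)) [p + length xs..<M]"
  have upt: "[0..<M] = [0..<p] @ [p..<p + length xs] @ [p + length xs..<M]"
    using M upt_split[of 0 p M] upt_split[of p "p + length xs" M] by simp
  have mid: "map (\<lambda>k. (w k, a k)) [p..<p + length xs] = xs"
    by (rule nth_equalityI) (simp_all add: xs)
  have mid': "map (\<lambda>k. (w' k, a' k)) [p..<p + length xs] = ys"
    by (rule nth_equalityI) (simp_all add: ys m[symmetric])
  have pre: "map (\<lambda>k. (w' k, a' k)) [0..<p] = prefix_pairs w a p"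
    unfolding prefix_pairs_def by (intro map_cong refl) (use out in auto)
  have post: "map (\<lambda>k. (w' k, a' k)) [p + length xs..<M] = ?z"
    by (intro map_cong refl) (use out in auto)
  have x: "prefix_pairs w a M = prefix_pairs w a p @ xs @ ?z"
    unfolding prefix_pairs_def upt map_append mid ..
  have y: "prefix_pairs w' a' M = prefix_pairs w a p @ ys @ ?z"
    unfolding prefix_pairs_def[of w' a' M] upt map_append mid' pre post ..
  have "map w [0..<M] = map fst (prefix_pairs w a M)"
    "map w' [0..<M] = map fst (prefix_pairs w' a' M)"
    by (simp_all add: map_fst_prefix_pairs)
  then have "pos (map w [0..<M]) = pos (map w' [0..<M])"
    unfolding x y map_append by (simp only:) (intro pos_append_cong refl eqs(2))
  then show "word_matrix (prefix_pairs (fst (w, a)) (snd (w, a)) M) =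
      word_matrix (prefix_pairs (fst (w', a')) (snd (w', a')) M) \<and>
      pos (map (fst (w, a)) [0..<M]) = pos (map (fst (w', a')) [0..<M])"
    by (simp add: x y mult_word_append eqs(1))
qed

lemma pos_refl_commute: "refl_commute n s t \<Longrightarrow> pos [s, t] = pos [t, s]"
proof (rule ext)
  fix x assume "refl_commute n s t"
  then have "sr s \<circ> sr t = sr t \<circ> sr s"
    by (simp add: refl_commute_def)
  from fun_cong[OF this, of x] show "pos [s, t] x = pos [t, s] x"
    by simp
qed

lemma rmul_same: "rmul s b (rmul s a X) = rmul s a (rmul s b X)"
proof (intro ext)
  fix r c
  show "rmul s b (rmul s a X) r c = rmul s a (rmul s b X) r c"
    using mod_Suc_neq[of "c - 2"] by (simp add: rmul_def algebra_simps)
qed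

lemma braid_adjacentD:
  assumes "braid_adjacent n s t" "s < n" "t < n"
  shows "2 < n" "int t mod int n = (int s + 1) mod int n \<or> int s mod int n = (int t + 1) mod int n"
  using assms unfolding braid_adjacent_def by (auto simp: of_nat_mod of_nat_add add.commute)

lemma transport_move_eventually_agree:
  assumes "transport_move n x y" "admissible x"
  shows "admissible y \<and> eventually_agree x y"
  using assms
proof cases
  case (1 w p a)
  let ?w' = "w(p := w (p + 1), p + 1 := w p)" and ?a' = "a(p := a (p + 1), p + 1 := a p)"
  have lt: "\<And>k. w k < n" "\<And>k. 0 < a k"
    using 1 assms(2) by (auto simp: admissible_def)
  have "eventually_agree (w, a) (?w', ?a')"
  proof (rule eventually_agree_local[where xs = "[(w p, a p), (w (p + 1), a (p + 1))]"
        and ys = "[(w (p + 1), a (p + 1)), (w p, a p)]" and p = p])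
    fix X
    show "mult_word X [(w p, a p), (w (p + 1), a (p + 1))] =
        mult_word X [(w (p + 1), a (p + 1)), (w p, a p)]"
      using refl_commute_cases[OF 1(3) lt(1) lt(1)] rmul_same rmul_commute by auto
  qed (use pos_refl_commute[OF 1(3)] in \<open>auto simp: less_Suc_eq numeral_2_eq_2\<close>)
  moreover have "admissible (?w', ?a')"
    using lt by (auto simp: admissible_def)
  ultimately show ?thesis
    using 1 by simp
next
  case (2 w p a)
  let ?s = "w p" and ?t = "w (p + 1)"
  let ?a = "a p" and ?b = "a (p + 1)" and ?c = "a (p + 2)"
  let ?w' = "w(p := ?t, p + 1 := ?s, p + 2 := ?t)"
  let ?a' = "a(p := ?b * ?c / (?a + ?c), p + 1 := ?a + ?c, p + 2 := ?a * ?b / (?a + ?c))"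
  have lt: "\<And>k. w k < n" "\<And>k. 0 < a k"
    using 2 assms(2) by (auto simp: admissible_def)
  note adj = braid_adjacentD[OF 2(3) lt(1) lt(1)]
  have "eventually_agree (w, a) (?w', ?a')"
  proof (rule eventually_agree_local[where xs = "[(?s, ?a), (?t, ?b), (?s, ?c)]"
        and ys = "[(?t, ?b * ?c / (?a + ?c)), (?s, ?a + ?c), (?t, ?a * ?b / (?a + ?c))]" and p = p])
    fix X
    show "mult_word X [(?s, ?a), (?t, ?b), (?s, ?c)] =
        mult_word X [(?t, ?b * ?c / (?a + ?c)), (?s, ?a + ?c), (?t, ?a * ?b / (?a + ?c))]"
      using rmul_braid[OF adj(1) _ adj(2), of ?a ?c ?b X] lt(2)[of p] lt(2)[of "p + 2"] by simp
  next
    have "pos [?s, ?t, ?s] = pos [?t, ?s, ?t]"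
      using adj(2) pos_braid[OF adj(1)] by metis
    then show "pos (map fst [(?s, ?a), (?t, ?b), (?s, ?c)]) =
        pos (map fst [(?t, ?b * ?c / (?a + ?c)), (?s, ?a + ?c), (?t, ?a * ?b / (?a + ?c))])"
      by simp
  qed (use 2(4) in \<open>auto simp: less_Suc_eq numeral_3_eq_3 numeral_2_eq_2\<close>)
  moreover have "admissible (?w', ?a')"
    using lt by (auto simp: admissible_def add_pos_pos)
  ultimately show ?thesis
    using 2 by simp
qed

lemma transport_eventually_agree:
  "(transport_move n)\<^sup>*\<^sup>* x y \<Longrightarrow> admissible x \<Longrightarrow> admissible y \<and> eventually_agree x y"
proof (induction rule: rtranclp_induct)
  case base
  then show ?case by (simp add: eventually_agree_refl)
next
  case (step y z)
  then have "admissible y" "eventually_agree x y" by auto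
  with transport_move_eventually_agree[OF step.hyps(2)] show ?case
    using eventually_agree_trans[of x y z] by simp
qed

lemma braid_move_transport:
  assumes "braid_move n w w'"
  shows "\<exists>a'. transport_move n (w, a) (w', a')"
  using assms
proof cases
  case (1 p)
  then show ?thesis
    using transport_move.intros(1)[OF 1(2), of a] by blast
next
  case (2 p)
  then show ?thesis
    using transport_move.intros(2)[OF 2(2,3), of a] by blast
qed

lemma braid_moves_transport:
  "(braid_move n)\<^sup>*\<^sup>* w w' \<Longrightarrow> \<exists>a'. (transport_move n)\<^sup>*\<^sup>* (w, a) (w', a')"
proof (induction rule: rtranclp_induct)
  case (step w' w'')
  obtain a' where a': "(transport_move n)\<^sup>*\<^sup>* (w, a) (w', a')"
    using step.IH by blast
  obtain a'' where "transport_move n (w', a') (w'', a'')"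
    using braid_move_transport[OF step.hyps(2)] by blast
  with a' have "(transport_move n)\<^sup>*\<^sup>* (w, a) (w'', a'')"
    by (rule rtranclp.rtrancl_into_rtrancl)
  then show ?case by blast
qed blast

definition reduced_seq :: "word \<Rightarrow> bool" where
  "reduced_seq w \<longleftrightarrow> (\<forall>M. reduced_list (map w [0..<M]))"

lemma reduced_seq_letter:
  assumes "reduced_seq w"
  shows "w k < n"
proof -
  have "reduced_list (map w [0..<Suc k])"
    using assms unfolding reduced_seq_def by blast
  then show ?thesis
    using reduced_list_letters by fastforce
qed

lemma reduced_seq_eventually_agree:
  assumes "reduced_seq w" "eventually_agree (w, a) (w', a')" "admissible (w', a')"
  shows "reduced_seq w'"
  unfolding reduced_seq_def
proof
  fix m
  obtain M0 where M0: "\<And>M. M0 \<le> M \<Longrightarrow> pos (map w [0..<M]) = pos (map w' [0..<M])"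
    using eventually_agreeE[OF assms(2)] by metis
  define M where "M = max m M0"
  have M: "m \<le> M" "M0 \<le> M"
    by (simp_all add: M_def)
  have "reduced_list (map w [0..<M])"
    using assms(1) unfolding reduced_seq_def by (rule spec)
  moreover have "set (map w' [0..<M]) \<subseteq> {..<n}"
    using assms(3) unfolding admissible_def by auto
  ultimately have "reduced_list (map w' [0..<M])"
    by (rule reduced_list_cong[OF _ _ M0[OF M(2), symmetric]]) simp
  then show "reduced_list (map w' [0..<m])"
    unfolding upt_split[OF le0 M(1)] map_append by (rule reduced_list_appendD(1))
qed

lemma pos_append_cancel: "pos (u @ v) = pos (u @ v') \<Longrightarrow> pos v = pos v'"
proof (rule ext)
  fix p assume eq: "pos (u @ v) = pos (u @ v')"
  obtain x where x: "pos u x = p"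
    by (rule pos_surj)
  from fun_cong[OF eq, of x] show "pos v p = pos v' p"
    unfolding pos_append x .
qed

text \<open>Cancelling the common first m letters from the equal permutations shows that the two
  remainders represent the same permutation, and then \<open>word_matrix_unique\<close> compares the
  parameters in front.\<close>

lemma eventually_agree_prefix:
  assumes "reduced_seq w" "admissible (w, a)" "admissible (w', a')"
    "eventually_agree (w, a) (w', a')"
    and eq: "\<And>k. k < m \<Longrightarrow> w' k = w k" and "k < m"
  shows "a' k = a k"
proof -
  have "reduced_seq w'"
    by (rule reduced_seq_eventually_agree[OF assms(1,4,3)])
  obtain M0 where M0: "\<And>M. M0 \<le> M
      \<Longrightarrow> word_matrix (prefix_pairs w a M) = word_matrix (prefix_pairs w' a' M)"
    "\<And>M. M0 \<le> M \<Longrightarrow> pos (map w [0..<M]) = pos (map w' [0..<M])"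
    using eventually_agreeE[OF assms(4)] by metis
  define M where "M = max m M0"
  have mM: "m \<le> M" "M0 \<le> M"
    by (auto simp: M_def)
  let ?q = "map (\<lambda>k. (w k, a k)) [m..<M]" and ?q' = "map (\<lambda>k. (w' k, a' k)) [m..<M]"
  have split: "map v [0..<M] = map v [0..<m] @ map v [m..<M]" for v
    using upt_split[OF le0 mM(1)] by simp
  have prefix_eq: "map w' [0..<m] = map w [0..<m]"
    using eq by simp
  have rdM: "reduced_list (map w [0..<M])" "reduced_list (map w' [0..<M])"
    using assms(1) \<open>reduced_seq w'\<close> by (simp_all add: reduced_seq_def)
  have "prefix_pairs w a m = prefix_pairs w' a' m"
  proof (rule word_matrix_unique[where qs = ?q and qs' = ?q'])
    show "map fst (prefix_pairs w a m) = map fst (prefix_pairs w' a' m)"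
      by (simp add: map_fst_prefix_pairs prefix_eq)
    show "positive (prefix_pairs w a m)" "positive (prefix_pairs w' a' m)" "positive ?q"
      "positive ?q'"
      using assms(2,3) by (simp_all add: positive_prefix_pairs) (auto simp: positive_def
          admissible_def)
    show "reduced_list (map fst (prefix_pairs w a m) @ map fst ?q)"
      "reduced_list (map fst (prefix_pairs w' a' m) @ map fst ?q')"
      using rdM unfolding map_fst_prefix_pairs split by (simp_all add: comp_def)
    have "pos (map w [0..<m] @ map w [m..<M]) = pos (map w [0..<m] @ map w' [m..<M])"
      using M0(2)[OF mM(2)] unfolding split prefix_eq .
    from pos_append_cancel[OF this] show "pos (map fst ?q) = pos (map fst ?q')"
      by (simp add: comp_def)
    show "word_matrix (prefix_pairs w a m @ ?q) = word_matrix (prefix_pairs w' a' m @ ?q')"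
      using M0(1)[OF mM(2)] unfolding prefix_pairs_split[OF mM(1)] .
  qed
  then have "prefix_pairs w a m ! k = prefix_pairs w' a' m ! k"
    by simp
  then show ?thesis
    using \<open>k < m\<close> by (simp add: prefix_pairs_def)
qed

lemma reduced_seq_if_reduced_word:
  assumes "reduced_word n w"
  shows "reduced_seq w"
  unfolding reduced_seq_def
proof
  fix M
  have lt: "\<And>k. w k < n" and len: "affine_length n (refl_prod n (map w [0..<M])) = M"
    using assms by (auto simp: reduced_word_def)
  show "reduced_list (map w [0..<M])"
    unfolding reduced_list_def
  proof (intro conjI allI impI)
    show "set (map w [0..<M]) \<subseteq> {..<n}"
      using lt by auto
    fix v assume v: "set v \<subseteq> {..<n}" "pos v = pos (map w [0..<M])"
    then have "refl_prod n v = refl_prod n (map w [0..<M])"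
      by (simp add: pos_eq_iff_refl_prod)
    then have "affine_length n (refl_prod n (map w [0..<M])) \<le> length v"
      unfolding affine_length_def using v(1) by (intro Least_le) blast
    then show "length (map w [0..<M]) \<le> length v"
      using len by simp
  qed
qed

subsection \<open>Particle hopping words\<close>

definition periodic :: "int set \<Rightarrow> bool" where
  "periodic L \<longleftrightarrow> (\<forall>x k. x + k * int n \<in> L \<longleftrightarrow> x \<in> L)"

lemma periodic_cong:
  assumes "periodic L" "x mod int n = y mod int n"
  shows "x \<in> L \<longleftrightarrow> y \<in> L"
proof -
  obtain k where "x = y + k * int n"
    using assms(2) by (rule mod_eqD)
  then show ?thesis
    using assms(1) by (simp add: periodic_def)
qed

text \<open>The integers are sites, and \<open>pos h x\<close> is the site of x after h. The
  appended letter is the residue of the site of x, so it exchanges x with its right neighbour y, and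
  all translates of this pair at the same time.\<close>

inductive hop :: "int set \<Rightarrow> nat list \<Rightarrow> bool" for L where
  Nil: "hop L []"
| snoc: "hop L h \<Longrightarrow> x \<notin> L \<Longrightarrow> y \<in> L \<Longrightarrow> pos h y = pos h x + 1 \<Longrightarrow>
    hop L (h @ [nat (pos h x mod int n)])"

lemma letter_mod: "int (nat (p mod int n)) mod int n = p mod int n"
  using n2 by simp

lemma letter_lt: "nat (p mod int n) < n"
  using n2 by (simp add: nat_less_iff)

lemma reduced_list_rev: "reduced_list u \<Longrightarrow> reduced_list (rev u)"
proof -
  assume u: "reduced_list u"
  have rev: "pos (rev w) (pos w x) = x" for w x
    by (induction w arbitrary: x) (simp_all add: pos_append)
  show "reduced_list (rev u)"
    unfolding reduced_list_def
  proof (intro conjI allI impI)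
    show "set (rev u) \<subseteq> {..<n}"
      using reduced_list_letters[OF u] by simp
    fix v assume v: "set v \<subseteq> {..<n}" "pos v = pos (rev u)"
    have "pos (rev v) x = pos u x" for x
      using rev[of v "pos u x"] rev[of u x] v(2) by simp
    then have "length u \<le> length (rev v)"
      using v(1) by (intro reduced_list_le[OF u]) auto
    then show "length (rev u) \<le> length v" by simp
  qed
qed

lemma reduced_list_ascent_right:
  assumes "reduced_list (u @ [t])" "pos u x mod int n = int t mod int n" "pos u y = pos u x + 1"
  shows "x < y"
proof -
  have rev: "pos (rev w) (pos w x) = x" for w x
    by (induction w arbitrary: x) (simp_all add: pos_append)
  have "reduced_list (t # rev u)"
    using reduced_list_rev[OF assms(1)] by simp
  from reduced_list_ascent_mod[OF this assms(2)] show ?thesis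
    by (simp only: assms(3)[symmetric] rev)
qed

text \<open>A letter undoing the inversion would act on the neighbouring sites of y and x, and
  reducedness forces the left one of these to hold the smaller value.\<close>

lemma inversion_snoc:
  assumes "reduced_list (u @ [t])" "x < y" "pos u y < pos u x"
  shows "pos (u @ [t]) y < pos (u @ [t]) x"
proof (rule ccontr)
  assume "\<not> ?thesis"
  moreover have "pos (u @ [t]) y \<noteq> pos (u @ [t]) x"
    using assms(2) by (simp add: pos_inj)
  ultimately have "sr t (pos u x) < sr t (pos u y)"
    by (simp add: pos_append)
  from sr_inverts[OF assms(3) this] have "y < x"
    by (intro reduced_list_ascent_right[OF assms(1)]) auto
  then show False
    using assms(2) by simp
qed

lemma inversion_mono:
  assumes "reduced_seq i" "x < y" "pos (map i [0..<M]) y < pos (map i [0..<M]) x" "M \<le> M'"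
  shows "pos (map i [0..<M']) y < pos (map i [0..<M']) x"
  using assms(4)
proof (induction M' rule: dec_induct)
  case base
  show ?case by (rule assms(3))
next
  case (step m)
  have "reduced_list (map i [0..<Suc m])"
    using assms(1) unfolding reduced_seq_def by (rule spec)
  then have "reduced_list (map i [0..<m] @ [i m])"
    by simp
  from inversion_snoc[OF this assms(2) step.IH] show ?case
    by simp
qed

text \<open>The pairs that a letter makes cross have the residues of its \<open>x0\<close> and
  \<open>y0\<close>, and membership in L depends on the residue alone.\<close>

lemma hop_inversion:
  assumes "hop L h" "periodic L" "x < y" "pos h y < pos h x"
  shows "x \<notin> L \<and> y \<in> L"
  using assms(1,4)
proof (induction rule: hop.induct)
  case Nil
  then show ?case using assms(3) by simp
next
  case (snoc h x0 y0)
  let ?t = "nat (pos h x0 mod int n)"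
  show ?case
  proof (cases "pos h y < pos h x")
    case True
    then show ?thesis by (rule snoc.IH)
  next
    case False
    then have lt: "pos h x < pos h y"
      using assms(3) by (metis linorder_neqE_linordered_idom pos_inj less_irrefl)
    have "sr ?t (pos h y) < sr ?t (pos h x)"
      using snoc.prems by (simp add: pos_append)
    from sr_inverts[OF lt this] have "pos h y = pos h x + 1"
      "pos h x mod int n = pos h x0 mod int n"
      unfolding letter_mod .
    then have "x mod int n = x0 mod int n" "y mod int n = y0 mod int n"
      using mod_Suc_cong[of "pos h x" "pos h x0"] snoc.hyps(4)
        pos_mod_cong[of h x x0] pos_mod_cong[of h y y0] by simp_all
    then show ?thesis
      using snoc.hyps(2,3) periodic_cong[OF assms(2)] by blast
  qed
qed

lemma hop_adjacent_less:
  assumes "hop L h" "periodic L" "x \<notin> L" "y \<in> L" "pos h x < pos h y"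
  shows "x < y"
proof (rule ccontr)
  assume "\<not> x < y"
  then have "y < x"
    using assms(3,4) by (cases "x = y") auto
  then show False
    using hop_inversion[OF assms(1,2)] assms(3-5) by blast
qed

text \<open>The letter s in front is itself a hop and renames the values, so what follows has to hop
  with respect to the preimage of L.\<close>

lemma hop_Cons:
  assumes "hop {x. sr s x \<in> L} h" "s < n" "int s \<notin> L" "int s + 1 \<in> L"
  shows "hop L (s # h)"
  using assms(1)
proof (induction rule: hop.induct)
  case Nil
  have "hop L ([] @ [nat (pos [] (int s) mod int n)])"
    by (rule hop.snoc[OF hop.Nil assms(3,4)]) simp
  then show ?case
    using assms(2) by simp
next
  case (snoc h x y)
  have "sr s x \<notin> L" "sr s y \<in> L"
    using snoc.hyps by simp_all
  from hop.snoc[OF snoc.IH this]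
  have "hop L ((s # h) @ [nat (pos (s # h) (sr s x) mod int n)])"
    using snoc.hyps by simp
  then show ?case by simp
qed

lemma hop_step:
  assumes "hop L h" "x \<notin> L" "y \<in> L" "pos h y = pos h x + 1"
  obtains t where "hop L (h @ [t])" "int t mod int n = pos h x mod int n"
  using hop.snoc[OF assms] letter_mod by blast

text \<open>If no hop were possible, all sites to the right of a value outside L would hold values
  outside L, but some translate of \<open>y0\<close> sits there.\<close>

lemma hop_extend_one:
  assumes "hop L h" "periodic L" "x0 \<notin> L" "y0 \<in> L"
  shows "\<exists>t. hop L (h @ [t])"
proof (rule ccontr)
  assume no: "\<nexists>t. hop L (h @ [t])"
  have step: "refl_prod n h (p + 1) \<notin> L" if "refl_prod n h p \<notin> L" for p
    using hop.snoc[OF assms(1) that, of "refl_prod n h (p + 1)"] no unfolding pos_refl_prod by blast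
  have *: "refl_prod n h (pos h x0 + int m) \<notin> L" for m
  proof (induction m)
    case 0
    then show ?case using assms(3) by (simp add: refl_prod_pos)
  next
    case (Suc m)
    have eq: "pos h x0 + int (Suc m) = pos h x0 + int m + 1"
      by simp
    show ?case
      unfolding eq by (rule step[OF Suc])
  qed
  \<comment> \<open>A shift by as many periods as the distance of the two sites certainly moves
    \<open>y0\<close> past \<open>x0\<close>.\<close>
  let ?k = "\<bar>pos h y0 - pos h x0\<bar>"
  have "?k \<le> ?k * int n"
    using n2 by (simp add: mult_le_cancel_left1)
  then have "pos h y0 + ?k * int n - pos h x0 \<ge> 0"
    by linarith
  then obtain m where m: "pos h y0 + ?k * int n = pos h x0 + int m"
    by (metis add.commute diff_add_cancel zero_le_imp_eq_int)
  have "refl_prod n h (pos h x0 + int m) = y0 + ?k * int n"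
    unfolding m[symmetric] pos_shift[symmetric] by (rule refl_prod_pos)
  then show False
    using *[of m] assms(2,4) by (simp add: periodic_def)
qed

lemma hop_extend:
  assumes "hop L h" "periodic L" "x0 \<notin> L" "y0 \<in> L"
  shows "\<exists>k. hop L (h @ k) \<and> length k = m"
proof (induction m)
  case 0
  then show ?case using assms(1) by simp
next
  case (Suc m)
  then obtain k where k: "hop L (h @ k)" "length k = m" by blast
  obtain t where "hop L ((h @ k) @ [t])"
    using hop_extend_one[OF k(1) assms(2-4)] by blast
  then show ?case
    using k(2) by (intro exI[of _ "k @ [t]"]) simp
qed

text \<open>
  Two consecutive values of the same kind never cross, and whatever separates them is of the other
  kind and can be hopped out of the way.
\<close>

lemma hop_make_adjacent:
  assumes "hop L h" "periodic L" "x \<in> L \<longleftrightarrow> x + 1 \<in> L"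
  shows "\<exists>k. hop L (h @ k) \<and> pos (h @ k) (x + 1) = pos (h @ k) x + 1"
  using assms(1)
proof (induction "nat (pos h (x + 1) - pos h x)" arbitrary: h rule: less_induct)
  case less
  note inv = hop_inversion[OF less.prems assms(2)]
  have lt: "pos h x < pos h (x + 1)"
  proof (rule ccontr)
    assume "\<not> ?thesis"
    moreover have "pos h x \<noteq> pos h (x + 1)"
      by (simp add: pos_inj)
    ultimately show False
      using inv[of x "x + 1"] assms(3) by simp
  qed
  have xne: "pos h (x + 1) mod int n \<noteq> pos h x mod int n"
    unfolding pos_mod_cong by (rule mod_Suc_neq)
  show ?case
  proof (cases "pos h (x + 1) = pos h x + 1")
    case True
    then show ?thesis
      using less.prems by (intro exI[of _ "[]"]) simp
  next
    case False
    then have gap: "pos h x + 1 < pos h (x + 1)"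
      using lt by simp
    have finish: ?thesis
      if t: "hop L (h @ [t])"
        "pos (h @ [t]) (x + 1) - pos (h @ [t]) x < pos h (x + 1) - pos h x" for t
    proof -
      have "nat (pos (h @ [t]) (x + 1) - pos (h @ [t]) x) < nat (pos h (x + 1) - pos h x)"
        using t(2) lt by linarith
      from less.hyps[OF this t(1)] obtain k where "hop L ((h @ [t]) @ k)"
        "pos ((h @ [t]) @ k) (x + 1) = pos ((h @ [t]) @ k) x + 1"
        by blast
      then show ?thesis
        by (intro exI[of _ "t # k"]) simp
    qed
    \<comment> \<open>The gap shrinks from its left end if the two values are outside L, since these
      move right, and from its right end if they are in L.\<close>
    show ?thesis
    proof (cases "x \<in> L")
      case False
      then have nL: "x \<notin> L" "x + 1 \<notin> L"
        using assms(3) by auto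
      obtain y where y: "pos h y = pos h x + 1"
        by (rule pos_surj)
      have "y \<in> L"
      proof (rule ccontr)
        assume yL: "y \<notin> L"
        have "\<not> y < x"
          using inv[of y x] y nL by auto
        moreover have "y \<noteq> x" "y \<noteq> x + 1"
          using y gap by auto
        ultimately have "x + 1 < y" by simp
        then show False
          using inv[of "x + 1" y] y gap yL by simp
      qed
      then obtain t where t: "hop L (h @ [t])" "int t mod int n = pos h x mod int n"
        using hop_step[OF less.prems nL(1) _ y] by blast
      have "pos (h @ [t]) x = pos h x + 1"
        using t(2) by (simp add: pos_append sr_up)
      moreover have "pos h (x + 1) mod int n \<noteq> (int t + 1) mod int n"
      proof
        assume "pos h (x + 1) mod int n = (int t + 1) mod int n"
        also have "\<dots> = pos h y mod int n"
          using mod_Suc_cong[OF t(2)] y by simp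
        finally have "x + 1 \<in> L \<longleftrightarrow> y \<in> L"
          using periodic_cong[OF assms(2), of "x + 1" y] by (simp only: pos_mod_cong)
        then show False
          using nL \<open>y \<in> L\<close> by simp
      qed
      then have "pos (h @ [t]) (x + 1) = pos h (x + 1)"
        using t(2) xne by (simp add: pos_append sr_fix)
      ultimately show ?thesis
        using finish[OF t(1)] by simp
    next
      case True
      then have L: "x \<in> L" "x + 1 \<in> L"
        using assms(3) by auto
      obtain y where y: "pos h y = pos h (x + 1) - 1"
        by (rule pos_surj)
      have "y \<notin> L"
      proof
        assume yL: "y \<in> L"
        have "\<not> x + 1 < y"
          using inv[of "x + 1" y] y L by auto
        moreover have "y \<noteq> x" "y \<noteq> x + 1"
          using y gap by auto
        ultimately have "y < x" by simp
        then show False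
          using inv[of y x] y gap yL by simp
      qed
      then obtain t where t: "hop L (h @ [t])" "int t mod int n = pos h y mod int n"
        using hop_step[OF less.prems _ L(2), of y] y by auto
      have t1: "pos h (x + 1) mod int n = (int t + 1) mod int n"
        using mod_Suc_cong[OF t(2)] y by simp
      then have "pos (h @ [t]) (x + 1) = pos h (x + 1) - 1"
        by (simp add: pos_append sr_down)
      moreover have "pos h x mod int n \<noteq> int t mod int n"
      proof
        assume "pos h x mod int n = int t mod int n"
        then have "x \<in> L \<longleftrightarrow> y \<in> L"
          using periodic_cong[OF assms(2), of x y] t(2) by (simp only: pos_mod_cong)
        then show False
          using L \<open>y \<notin> L\<close> by simp
      qed
      then have "pos (h @ [t]) x = pos h x"
        using t1 xne by (simp add: pos_append sr_fix)
      ultimately show ?thesis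
        using finish[OF t(1)] by simp
    qed
  qed
qed

lemma hop_snoc_pos:
  assumes "periodic L" "x0 \<notin> L" "y0 \<in> L" "pos h y0 = pos h x0 + 1" "x \<notin> L"
  shows "pos (h @ [nat (pos h x0 mod int n)]) x = pos h x + (if x mod int n =
      x0 mod int n then 1 else 0)"
proof -
  let ?t = "nat (pos h x0 mod int n)"
  have "pos h x mod int n \<noteq> (int ?t + 1) mod int n"
  proof
    assume "pos h x mod int n = (int ?t + 1) mod int n"
    also have "\<dots> = pos h y0 mod int n"
      unfolding assms(4) by (rule mod_Suc_cong[OF letter_mod])
    finally show False
      using periodic_cong[OF assms(1), of x y0] assms(3,5) by (simp only: pos_mod_cong)
  qed
  moreover have "pos h x mod int n = int ?t mod int n \<longleftrightarrow> x mod int n = x0 mod int n"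
    unfolding letter_mod by (rule pos_mod_cong)
  ultimately show ?thesis
    by (simp add: pos_append simple_refl_def)
qed

text \<open>Each letter moves exactly one residue class outside L, by one site to the right.\<close>

lemma hop_length:
  assumes "hop L h" "periodic L"
  shows "(\<Sum>x\<in>{0..<int n}. if x \<in> L then 0 else pos h x - x) = int (length h)"
  using assms(1)
proof (induction rule: hop.induct)
  case Nil
  then show ?case by (simp add: sum.neutral)
next
  case (snoc h x0 y0)
  let ?h = "h @ [nat (pos h x0 mod int n)]"
  have "(\<Sum>x\<in>{0..<int n}. if x \<in> L then 0 else pos ?h x - x) =
      (\<Sum>x\<in>{0..<int n}. (if x \<in> L then 0 else pos h x - x) + (if x mod int n =
          x0 mod int n then 1 else 0))"
  proof (rule sum.cong[OF refl])
    fix x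
    have "x \<in> L \<Longrightarrow> x mod int n \<noteq> x0 mod int n"
      using periodic_cong[OF assms(2)] snoc.hyps(2) by blast
    then show "(if x \<in> L then 0 else pos ?h x - x) =
        (if x \<in> L then 0 else pos h x - x) + (if x mod int n = x0 mod int n then 1 else 0)"
      using hop_snoc_pos[OF assms(2) snoc.hyps(2-4), of x] by (cases "x \<in> L") simp_all
  qed
  also have "\<dots> = int (length ?h)"
    unfolding sum.distrib snoc.IH sum_residue by simp
  finally show ?case .
qed

text \<open>Pigeonhole over the n residue classes, applied to the total displacement in
  \<open>hop_length\<close>.\<close>

lemma hop_far:
  assumes "hop L h" "periodic L" "n * D \<le> length h" "0 < D"
  obtains x where "x \<notin> L" "int D \<le> pos h x - x"
proof (rule ccontr)
  assume no: "\<not> thesis"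
  have "(\<Sum>x\<in>{0..<int n}. if x \<in> L then 0 else pos h x - x) \<le> (\<Sum>x\<in>{0..<int n}. int D - 1)"
  proof (rule sum_mono)
    fix x
    show "(if x \<in> L then 0 else pos h x - x) \<le> int D - 1"
      using that[of x] no assms(4) by fastforce
  qed
  also have "\<dots> = int n * int D - int n"
    by (simp add: algebra_simps)
  also have "\<dots> < int (n * D)"
    using n2 by simp
  also have "\<dots> \<le> int (length h)"
    using assms(3) by (rule of_nat_mono)
  finally show False
    using hop_length[OF assms(1,2)] by simp
qed

text \<open>When x steps from site p to p + 1, the new generator adds a positive multiple of the
  entry in column p to column p + 1. So the positive stretch of row x always extends to the current
  site of x.\<close>

lemma hop_entry:
  assumes "hop L h" "periodic L" "map fst ps = h" "positive ps" "x \<notin> L"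
  shows "x \<le> pos h x" and "x \<le> c \<Longrightarrow> c \<le> pos h x \<Longrightarrow> 0 < word_matrix ps x c"
proof -
  have "x \<le> pos h x \<and> (\<forall>c. x \<le> c \<longrightarrow> c \<le> pos h x \<longrightarrow> 0 < word_matrix ps x c)"
    using assms(1,3,4)
  proof (induction arbitrary: ps rule: hop.induct)
    case Nil
    then show ?case by (auto simp: unfolded_one_def)
  next
    case (snoc h x0 y0)
    let ?t = "nat (pos h x0 mod int n)"
    obtain qs b where ps: "ps = qs @ [(?t, b)]" "map fst qs = h"
      using snoc.prems(1) by (cases ps rule: rev_cases) auto
    have b: "0 < b" "positive qs"
      using snoc.prems(2) ps(1) by auto
    have mult_word: "word_matrix ps = rmul ?t b (word_matrix qs)"
      by (simp add: ps(1) mult_word_append)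
    have IH: "x \<le> pos h x" "\<And>c. x \<le> c \<Longrightarrow> c \<le> pos h x \<Longrightarrow> 0 < word_matrix qs x c"
      using snoc.IH[OF ps(2) b(2)] by auto
    have nn: "nonneg (word_matrix qs)"
      using b nonneg_mult_word nonneg_one by blast
    note new = hop_snoc_pos[OF assms(2) snoc.hyps(2-4) assms(5)]
    have "0 < word_matrix ps x c" if c: "x \<le> c" "c \<le> pos (h @ [?t]) x" for c
    proof (cases "c \<le> pos h x")
      case True
      then show ?thesis
        using IH(2)[OF c(1)] rmul_ge[OF nn, of b x c ?t] b(1) by (simp add: mult_word)
    next
      case False
      then have x: "x mod int n = x0 mod int n" and c1: "c - 1 = pos h x"
        using c(2) unfolding new by (auto split: if_splits)
      then have "(c - 1) mod int n = int ?t mod int n"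
        unfolding c1 letter_mod by (simp only: pos_mod_cong)
      then have "word_matrix ps x c = word_matrix qs x c + b * word_matrix qs x (c - 1)"
        unfolding mult_word by (rule rmul_hit)
      moreover have "0 < b * word_matrix qs x (c - 1)"
        using IH b(1) by (simp add: c1)
      ultimately show ?thesis
        using nn by (simp add: nonneg_def add_nonneg_pos)
    qed
    moreover have "x \<le> pos (h @ [?t]) x"
      using IH(1) unfolding new by simp
    ultimately show ?case by blast
  qed
  then show "x \<le> pos h x" "x \<le> c \<Longrightarrow> c \<le> pos h x \<Longrightarrow> 0 < word_matrix ps x c"
    by auto
qed

text \<open>
  The totally positive exchange step: the entries in row \<open>x\<close> and columns \<open>t\<close>, \<open>t + 1\<close>, far away from
  the diagonal, show that the parameter leaving on the right is small.
\<close>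

lemma exit_bound:
  assumes hop: "hop L (map fst (hs @ ks))" and per: "periodic L"
    and long: "n * (n + length hs) \<le> length (hs @ ks)"
    and positive: "positive hs" "positive ks" "positive hs'" "0 < a"
    and mult_word: "word_matrix ((s, a) # hs @ ks) = word_matrix (hs' @ [(t, c)])"
  shows "c \<le> mass ks"
proof -
  have "0 < n + length hs"
    using n2 by simp
  then obtain x0 where x0: "x0 \<notin> L" "int (n + length hs) \<le> pos (map fst (hs @ ks)) x0 - x0"
    using hop_far[OF hop per _] long by (metis length_map)
  let ?p = "pos (map fst (hs @ ks))"
  \<comment> \<open>Shifting by k periods brings the site of \<open>x0\<close> into the period
    starting at t; the displacement and membership in L are unchanged.\<close>
  define k where "k = (?p x0 - int t) div int n"
  define x where "x = x0 + (- k) * int n"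
  have x: "x \<notin> L"
    using x0(1) per by (simp add: x_def periodic_def del: minus_mult_left[symmetric])
  have px: "?p x = ?p x0 - k * int n"
    unfolding x_def pos_shift by simp
  have "?p x - int t = (?p x0 - int t) mod int n"
    unfolding px k_def using minus_div_mult_eq_mod[of "?p x0 - int t" "int n"] by simp
  then have bounds: "int t \<le> ?p x" "?p x < int t + int n"
    using n2 pos_mod_bound[of "int n" "?p x0 - int t"] pos_mod_sign[of "int n"
      "?p x0 - int t"] by linarith+
  have "?p x - x = ?p x0 - x0"
    unfolding px by (simp add: x_def)
  \<comment> \<open>The summand n in the length bound pays for going back from the site of x to
    column t, which is fewer than n columns.\<close>
  then have xt: "x + int (length hs) < int t"
    using bounds x0(2) by simp
  let ?Z = "word_matrix ((s, a) # hs @ ks)"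
  have nn: "nonneg (word_matrix (hs @ ks))" "nonneg (word_matrix ((s, a) # hs))"
    using positive by (intro nonneg_mult_word nonneg_one; simp)+
  have "0 < word_matrix (hs @ ks) x (int t)"
    using hop_entry(2)[OF hop per refl _ x, of "int t"] positive xt bounds by simp
  also have "\<dots> \<le> ?Z x (int t)"
    unfolding word_matrix_Cons using nn(1) positive(4) by (simp add: lmul_def nonneg_def)
  finally have Zpos: "0 < ?Z x (int t)" .
  \<comment> \<open>Column t + 1 is outside the band of the generators in front of
    \<open>ks\<close>, so the whole entry there is produced by \<open>ks\<close>.\<close>
  have far: "word_matrix ((s, a) # hs) x (int t + 1) = 0"
    using xt by (intro word_matrix_far) simp
  have Z: "?Z = mult_word (word_matrix ((s, a) # hs)) ks"
    by (simp only: mult_word_append append_Cons[symmetric])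
  have le: "?Z x (int t + 1) \<le> mass ks * ?Z x (int t)"
    using mult_word_superdiag_le[OF nn(2) positive(2), of x "int t"] unfolding far Z by simp
  let ?Y = "word_matrix hs'"
  have Y: "nonneg ?Y"
    using positive(3) nonneg_mult_word nonneg_one by blast
  have ZY: "?Z = rmul t c ?Y"
    by (simp only: mult_word) (simp add: mult_word_append)
  \<comment> \<open>The last generator feeds column t + 1 from column t and leaves column t itself
    alone.\<close>
  have "?Z x (int t) = ?Y x (int t)"
    unfolding ZY using mod_Suc_neq[of "int t - 1"] by (intro rmul_miss) simp
  moreover have "?Z x (int t + 1) = ?Y x (int t + 1) + c * ?Y x (int t)"
    unfolding ZY by (subst rmul_hit) simp_all
  ultimately have "c * ?Z x (int t) \<le> ?Z x (int t + 1)"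
    using Y by (simp add: nonneg_def)
  then have "c * ?Z x (int t) \<le> mass ks * ?Z x (int t)"
    using le by linarith
  then show ?thesis
    using Zpos by (simp only: mult_le_cancel_right_pos)
qed

subsection \<open>Factoring hopping words out of an infinite product\<close>

text \<open>Says that i eventually makes every crossing a hopping word for L may ask for. For
  periodic L it applies to all translates, so L drifts infinitely far to the left of the
  rest.\<close>

definition compat :: "word \<Rightarrow> int set \<Rightarrow> bool" where
  "compat i L \<longleftrightarrow> (\<forall>x y. x \<notin> L \<longrightarrow> y \<in> L \<longrightarrow> x < y \<longrightarrow>
     (\<exists>M. pos (map i [0..<M]) y < pos (map i [0..<M]) x))"

text \<open>Reducedness and the permutation are carried along with the matrix because uniqueness of
  parameters needs all three.\<close>

definition factors :: "word \<Rightarrow> params \<Rightarrow> nat \<Rightarrow> (nat \<times> real) list \<Rightarrow> (nat \<times> real) list \<Rightarrow> bool" where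
  "factors i a M ps qs \<longleftrightarrow> positive (ps @ qs) \<and> reduced_list (map fst (ps @ qs)) \<and>
     pos (map fst (ps @ qs)) = pos (map i [0..<M])
         \<and> word_matrix (ps @ qs) = word_matrix (prefix_pairs i a M)"

lemma factorsD:
  assumes "factors i a M ps qs"
  shows "positive ps" "positive qs" "reduced_list (map fst ps @ map fst qs)"
    "pos (map fst ps @ map fst qs) = pos (map i [0..<M])"
      "word_matrix (ps @ qs) = word_matrix (prefix_pairs i a M)"
  using assms unfolding factors_def by simp_all

lemma reduced_list_prefix: "reduced_seq i \<Longrightarrow> reduced_list (map i [0..<M])"
  unfolding reduced_seq_def by (rule spec)

lemma factors_length:
  assumes "reduced_seq i" "factors i a M ps qs"
  shows "length ps + length qs = M"
  using reduced_list_length_eq[OF factorsD(3)[OF assms(2)] reduced_list_prefix[OF assms(1)]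
      factorsD(4)[OF assms(2)]] by simp

lemma factors_msum:
  assumes "reduced_seq i" "factors i a M ps qs"
  shows "mass ps + mass qs = (\<Sum>k<M. a k)"
proof -
  have "fst ` set (ps @ qs) \<subseteq> {..<n}"
    using reduced_list_letters[OF factorsD(3)[OF assms(2)]] by (simp add: image_Un)
  moreover have "fst ` set (prefix_pairs i a M) \<subseteq> {..<n}"
    using reduced_seq_letter[OF assms(1)] by (auto simp: prefix_pairs_def)
  ultimately show ?thesis
    using mass_eqI[OF factorsD(5)[OF assms(2)]] by (simp add: mass_prefix_pairs)
qed

lemma factors_mono:
  assumes "reduced_seq i" "admissible (i, a)" "factors i a M ps qs" "M \<le> M'"
  shows "\<exists>qs'. factors i a M' ps qs'"
proof -
  let ?t = "map (\<lambda>k. (i k, a k)) [M..<M']"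
  note F = factorsD[OF assms(3)]
  have "positive ?t"
    using assms(2) by (auto simp: positive_def admissible_def)
  then have positive: "positive (ps @ qs @ ?t)"
    using F by simp
  have split: "map i [0..<M'] = map i [0..<M] @ map i [M..<M']"
    using upt_split[OF le0 assms(4)] by simp
  have fst: "map fst (ps @ qs @ ?t) = (map fst ps @ map fst qs) @ map i [M..<M']"
    by (simp add: comp_def)
  have pos: "pos (map fst (ps @ qs @ ?t)) = pos (map i [0..<M'])"
    unfolding fst split by (rule pos_append_cong[OF F(4) refl])
  have letters: "set (map fst (ps @ qs @ ?t)) \<subseteq> {..<n}"
    unfolding fst using reduced_list_letters[OF F(3)] reduced_seq_letter[OF assms(1)] by auto
  have "length (map fst (ps @ qs @ ?t)) = length (map i [0..<M'])"
    using factors_length[OF assms(1,3)] assms(4) by simp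
  then have reduced_list: "reduced_list (map fst (ps @ qs @ ?t))"
    by (rule reduced_list_cong[OF reduced_list_prefix[OF assms(1)] letters pos])
  have "word_matrix (ps @ qs @ ?t) = mult_word (word_matrix (ps @ qs)) ?t"
    by (simp add: mult_word_append)
  also have "\<dots> = word_matrix (prefix_pairs i a M')"
    unfolding F(5) prefix_pairs_split[OF assms(4)] by (simp add: mult_word_append)
  finally show ?thesis
    using positive reduced_list pos unfolding factors_def by blast
qed

text \<open>After extension to a common length both remainders represent the same permutation. Hence
  the parameters of an initial factor are fixed by its letters, whatever the remainder and the
  length of the prefix.\<close>

lemma factors_unique:
  assumes i: "reduced_seq i" "admissible (i, a)" and F: "factors i a M ps qs"
    "factors i a M' ps' qs'"
    and eq: "map fst ps = map fst ps'"
  shows "ps = ps'"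
proof -
  let ?M = "max M M'"
  obtain rs where rs: "factors i a ?M ps rs"
    using factors_mono[OF i F(1), of ?M] by auto
  obtain rs' where rs': "factors i a ?M ps' rs'"
    using factors_mono[OF i F(2), of ?M] by auto
  note R = factorsD[OF rs] and R' = factorsD[OF rs']
  have "pos (map fst ps @ map fst rs) = pos (map fst ps @ map fst rs')"
    using R(4) R'(4) eq by simp
  then have "pos (map fst rs) = pos (map fst rs')"
    by (rule pos_append_cancel)
  then show ?thesis
    using R R' eq by (intro word_matrix_unique[of ps ps' rs rs']) simp_all
qed

lemma factors_shift: "factors i a M (ps @ ks) qs \<Longrightarrow> factors i a M ps (ks @ qs)"
  by (simp add: factors_def)

lemma map_upt_Cons: "map i [0..<Suc M] = i 0 # map (\<lambda>k. i (Suc k)) [0..<M]"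
  by (simp add: map_upt_Suc del: upt_Suc)

lemma prefix_pairs_Cons: "prefix_pairs i a (Suc M) =
    (i 0, a 0) # prefix_pairs (\<lambda>k. i (Suc k)) (\<lambda>k. a (Suc k)) M"
  by (simp add: prefix_pairs_def map_upt_Suc del: upt_Suc)

lemma factors_Cons:
  assumes "reduced_seq i" "admissible (i, a)" "reduced_seq (\<lambda>k. i (Suc k))"
    "factors (\<lambda>k. i (Suc k)) (\<lambda>k. a (Suc k)) M ps qs"
  shows "factors i a (Suc M) ((i 0, a 0) # ps) qs"
proof -
  note F = factorsD[OF assms(4)]
  have pos: "pos (map fst (((i 0, a 0) # ps) @ qs)) = pos (map i [0..<Suc M])"
    using pos_Cons_cong[OF F(4), of "i 0"] by (simp only: map_upt_Cons) simp
  have "set (map fst (((i 0, a 0) # ps) @ qs)) \<subseteq> {..<n}"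
    using reduced_list_letters[OF F(3)] reduced_seq_letter[OF assms(1)] by simp
  moreover have "length (map fst (((i 0, a 0) # ps) @ qs)) = length (map i [0..<Suc M])"
    using factors_length[OF assms(3,4)] by simp
  ultimately have "reduced_list (map fst (((i 0, a 0) # ps) @ qs))"
    by (rule reduced_list_cong[OF reduced_list_prefix[OF assms(1)] _ pos])
  moreover have "word_matrix (((i 0, a 0) # ps) @ qs) = word_matrix (prefix_pairs i a (Suc M))"
    by (simp only: append_Cons prefix_pairs_Cons word_matrix_Cons F(5))
  moreover have "positive (((i 0, a 0) # ps) @ qs)"
    using F assms(2) by (simp add: admissible_def)
  ultimately show ?thesis
    using pos unfolding factors_def by blast
qed

text \<open>The next hop inverts a pair x < y, which by \<open>compat\<close> a sufficiently long
  prefix of i inverts too. The remainder then has a descent at the letter of the hop, so it can be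
  rewritten with this letter in front.\<close>

lemma hop_factor:
  assumes i: "reduced_seq i" "admissible (i, a)" and L: "periodic L" "compat i L" and "hop L h"
  shows "\<exists>M ps qs. map fst ps = h \<and> factors i a M ps qs"
  using assms(5)
proof (induction rule: hop.induct)
  case Nil
  have "factors i a 0 [] []"
    using reduced_list_prefix[OF i(1), of 0] by (simp add: factors_def prefix_pairs_def)
  then show ?case by force
next
  case (snoc h x y)
  define t where "t = nat (pos h x mod int n)"
  obtain M ps qs where ps: "map fst ps = h" "factors i a M ps qs"
    using snoc.IH by blast
  have xy: "x < y"
    using hop_adjacent_less[OF snoc.hyps(1) L(1) snoc.hyps(2,3)] snoc.hyps(4) by simp
  obtain M1 where M1: "pos (map i [0..<M1]) y < pos (map i [0..<M1]) x"
    using L(2) snoc.hyps(2,3) xy unfolding compat_def by blast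
  define M2 where "M2 = max M M1"
  obtain rs where rs: "factors i a M2 ps rs"
    using factors_mono[OF i ps(2), of M2] by (auto simp: M2_def)
  note R = factorsD[OF rs]
  have "pos (map i [0..<M2]) y < pos (map i [0..<M2]) x"
    by (rule inversion_mono[OF i(1) xy M1]) (simp add: M2_def)
  then have lt: "pos (map fst rs) (pos h x + 1) < pos (map fst rs) (pos h x)"
    unfolding R(4)[symmetric] pos_append ps(1) snoc.hyps(4) .
  have "pos h x mod int n = int t mod int n"
    unfolding t_def letter_mod ..
  then obtain k where k: "pos h x = int t + k * int n"
    by (rule mod_eqD)
  have "pos h x + 1 = int t + 1 + k * int n"
    using k by simp
  with lt have "pos (map fst rs) (int t + 1) < pos (map fst rs) (int t)"
    unfolding k by (simp only: pos_shift add_less_cancel_right)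
  moreover have "reduced_list (map fst rs)"
    using reduced_list_appendD(2)[OF R(3)] .
  ultimately obtain z where z: "reduced_list (t # z)" "pos (t # z) = pos (map fst rs)"
    "length (t # z) = length (map fst rs)"
    using descent_first[of "map fst rs" t] letter_lt t_def by metis
  have "same_matrices (map fst rs) (t # z)"
    using same_matrices_if_reduced[OF \<open>reduced_list (map fst rs)\<close> z(1) z(2)[symmetric]] .
  then obtain us where us: "map fst us = t # z" "positive us" "word_matrix us = word_matrix rs"
    using same_matricesE[OF _ R(2)] by metis
  then obtain c vs where vs: "us = (t, c) # vs" "map fst vs = z"
    by (cases us) auto
  let ?ps = "ps @ [(t, c)]"
  have fst: "map fst (?ps @ vs) = map fst ps @ (t # z)"
    by (simp add: vs(2))
  have pos: "pos (map fst (?ps @ vs)) = pos (map fst ps @ map fst rs)"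
    unfolding fst by (rule pos_append_cong[OF refl z(2)])
  have reduced_list: "reduced_list (map fst (?ps @ vs))"
  proof (rule reduced_list_cong[OF R(3) _ pos])
    show "set (map fst (?ps @ vs)) \<subseteq> {..<n}"
      unfolding fst using reduced_list_letters[OF R(3)] reduced_list_letters[OF z(1)] by auto
    show "length (map fst (?ps @ vs)) = length (map fst ps @ map fst rs)"
      unfolding fst using z(3) by simp
  qed
  have "word_matrix (?ps @ vs) = word_matrix (ps @ us)"
    by (simp add: vs(1))
  also have "\<dots> = word_matrix (prefix_pairs i a M2)"
    using word_matrix_append_cong[OF us(3), of ps] R(5) by simp
  finally have "factors i a M2 ?ps vs"
    unfolding factors_def using pos R reduced_list us(2) vs(1) by simp
  then show ?case
    using ps(1) t_def by (intro exI[of _ M2] exI[of _ ?ps] exI[of _ vs]) simp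
qed

text \<open>A first letter moving an element s of L to the right over s + 1 is impossible: by
  \<open>compat\<close>, s + n has to overtake s + 1 eventually, while reducedness keeps s + 1 to
  the left of s and so of s + n.\<close>

lemma compat_tail:
  assumes i: "reduced_seq i" and L: "periodic L" "compat i L"
  shows "\<not> (int (i 0) \<in> L \<and> int (i 0) + 1 \<notin> L)" "compat (\<lambda>k. i (Suc k)) {x. sr (i 0) x \<in> L}"
proof -
  let ?s = "i 0" and ?v = "\<lambda>k. i (Suc k)"
  show not: "\<not> (int ?s \<in> L \<and> int ?s + 1 \<notin> L)"
  proof
    assume s: "int ?s \<in> L \<and> int ?s + 1 \<notin> L"
    have "int ?s + 1 * int n \<in> L"
      using s L(1) unfolding periodic_def by blast
    moreover have "int ?s + 1 < int ?s + 1 * int n"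
      using n2 by simp
    ultimately obtain M where M: "pos (map i [0..<M]) (int ?s + 1 * int n)
        < pos (map i [0..<M]) (int ?s + 1)"
      using L(2) s unfolding compat_def by blast
    have M0: "M \<noteq> 0"
    proof
      assume "M = 0"
      then show False using M n2 by simp
    qed
    then obtain M' where M': "M = Suc M'"
      using not0_implies_Suc by blast
    have "reduced_list (?s # map ?v [0..<M'])"
      using reduced_list_prefix[OF i, of M] unfolding M' map_upt_Cons .
    from reduced_list_ascent[OF this] have "pos (map i [0..<M]) (int ?s + 1)
        < pos (map i [0..<M]) (int ?s)"
      unfolding M' map_upt_Cons by simp
    then show False
      using M n2 unfolding pos_shift by simp
  qed
  show "compat ?v {x. sr ?s x \<in> L}"
    unfolding compat_def
  proof (intro allI impI)
    fix x y assume xy: "x \<notin> {x. sr ?s x \<in> L}" "y \<in> {x. sr ?s x \<in> L}" "x < y"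
    \<comment> \<open>The letter could only reverse a pair of neighbours, and reversing this one
      would be the excluded case.\<close>
    have "sr ?s x < sr ?s y"
    proof (rule ccontr)
      assume "\<not> ?thesis"
      moreover have "sr ?s x \<noteq> sr ?s y"
        using xy by auto
      ultimately have "sr ?s y < sr ?s x" by simp
      note inv = sr_inverts[OF xy(3) this]
      have "sr ?s x = x + 1" "sr ?s y = x"
        using sr_up[OF inv(2)] sr_down[of y ?s] mod_Suc_cong[OF inv(2)] inv(1) by simp_all
      then have "x \<in> L" "x + 1 \<notin> L"
        using xy by auto
      then show False
        using not periodic_cong[OF L(1) inv(2)] periodic_cong[OF L(1) mod_Suc_cong[OF inv(2)]]
            by blast
    qed
    then obtain M where M: "pos (map i [0..<M]) (sr ?s y) < pos (map i [0..<M]) (sr ?s x)"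
      using L(2) xy unfolding compat_def by blast
    have "M \<noteq> 0"
    proof
      assume "M = 0"
      then show False using M \<open>sr ?s x < sr ?s y\<close> by simp
    qed
    then obtain M' where M': "M = Suc M'"
      using not0_implies_Suc by blast
    from M show "\<exists>M. pos (map ?v [0..<M]) y < pos (map ?v [0..<M]) x"
      unfolding M' map_upt_Cons by (intro exI[of _ M']) simp
  qed
qed

text \<open>
  Induction on the first letter \<open>s\<close>. If \<open>s\<close> exchanges two values of the same kind, it commutes past a
  long hopping word, and \<open>exit_bound\<close> shows that almost all of its parameter is absorbed by that word.
\<close>

lemma hop_mass:
  assumes "reduced_seq i" "admissible (i, a)" "periodic L" "compat i L" "x0 \<notin> L" "y0 \<in> L" "0 < e"
  shows "\<exists>M ps qs. hop L (map fst ps) \<and> factors i a M ps qs \<and> (\<Sum>k<N. a k) - e < mass ps"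
  using assms(1-6)
proof (induction N arbitrary: i a L x0 y0)
  case 0
  have "factors i a 0 [] []"
    using reduced_list_prefix[OF 0(1), of 0] by (simp add: factors_def prefix_pairs_def)
  then show ?case
    using assms(7) hop.Nil by (intro exI[of _ 0] exI[of _ "[]"]) simp
next
  case (Suc N)
  note i = Suc.prems(1,2) and L = Suc.prems(3,4)
  define s where "s = i 0"
  let ?v = "\<lambda>k. i (Suc k)" and ?b = "\<lambda>k. a (Suc k)" and ?L = "{x. sr s x \<in> L}"
  have s: "s < n"
    using reduced_seq_letter[OF i(1)] by (simp add: s_def)
  have v: "reduced_seq ?v" "admissible (?v, ?b)"
  proof -
    have "reduced_list (map ?v [0..<M])" for M
      using reduced_list_prefix[OF i(1), of "Suc M"] unfolding map_upt_Cons
        by (rule reduced_list_ConsD)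
    then show "reduced_seq ?v" by (simp add: reduced_seq_def)
    show "admissible (?v, ?b)"
      using i(2) by (simp add: admissible_def)
  qed
  have sum: "(\<Sum>k<Suc N. a k) = a 0 + (\<Sum>k<N. ?b k)"
    by (rule sum.lessThan_Suc_shift)
  have a0: "0 < a 0"
    using i(2) by (simp add: admissible_def)
  have tail: "\<not> (int s \<in> L \<and> int s + 1 \<notin> L)" "compat ?v ?L"
    using compat_tail[OF i(1) L] by (simp_all add: s_def)
  have perL: "periodic ?L"
    using L(1) by (simp add: periodic_def sr_shift)
  have mem: "sr s x0 \<notin> ?L" "sr s y0 \<in> ?L"
    using Suc.prems(5,6) by simp_all
  obtain M ps qs where IH: "hop ?L (map fst ps)" "factors ?v ?b M ps qs"
    "(\<Sum>k<N. ?b k) - e < mass ps"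
    using Suc.IH[OF v perL tail(2) mem] by blast
  show ?case
  proof (cases "int s \<notin> L \<and> int s + 1 \<in> L")
    case True
    \<comment> \<open>Here the first letter is a hop, so it is kept with its full parameter in front
      of the word found for the tail.\<close>
    have "hop L (map fst ((i 0, a 0) # ps))"
      using hop_Cons[OF IH(1) s] True by (simp add: s_def)
    moreover have "factors i a (Suc M) ((i 0, a 0) # ps) qs"
      by (rule factors_Cons[OF i v(1) IH(2)])
    moreover have "(\<Sum>k<Suc N. a k) - e < mass ((i 0, a 0) # ps)"
      unfolding sum using IH(3) by simp
    ultimately show ?thesis by blast
  next
    case False
    then have iff: "int s \<in> L \<longleftrightarrow> int s + 1 \<in> L"
      using tail(1) by blast
    have LL: "?L = L"
    proof (rule set_eqI)
      fix x
      consider "x mod int n = int s mod int n" | "x mod int n = (int s + 1) mod int n"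
        | "x mod int n \<noteq> int s mod int n" "x mod int n \<noteq> (int s + 1) mod int n"
        by blast
      then show "x \<in> ?L \<longleftrightarrow> x \<in> L"
      proof cases
        case 1
        show ?thesis
          using sr_up[OF 1] periodic_cong[OF L(1) 1] periodic_cong[OF L(1) mod_Suc_cong[OF 1]] iff
              by simp
      next
        case 2
        show ?thesis
          using sr_down[OF 2] periodic_cong[OF L(1) 2] periodic_cong[OF L(1) mod_pred[OF 2]] iff
              by simp
      next
        case 3
        then show ?thesis by (simp add: sr_fix)
      qed
    qed
    have hop0: "hop L (map fst ps)" and compat: "compat ?v L"
      using IH(1) tail(2) unfolding LL by auto
    \<comment> \<open>The length demanded by \<open>exit_bound\<close>, with \<open>ps\<close> as
      the short initial piece.\<close>
    obtain k1 where k1: "hop L (map fst ps @ k1)" "length k1 = n * (n + length ps)"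
      using hop_extend[OF hop0 L(1) Suc.prems(5,6)] by blast
    \<comment> \<open>Once s and s + 1 occupy neighbouring sites, the letter s commutes past the
      whole word by \<open>pos_commute\<close>.\<close>
    obtain k2 where k2: "hop L ((map fst ps @ k1) @ k2)"
      "pos ((map fst ps @ k1) @ k2) (int s + 1) = pos ((map fst ps @ k1) @ k2) (int s) + 1"
      using hop_make_adjacent[OF k1(1) L(1) iff] by blast
    define h where "h = (map fst ps @ k1) @ k2"
    have h: "hop L h" "pos h (int s + 1) = pos h (int s) + 1"
      using k2 by (simp_all only: h_def)
    obtain M3 ps3 qs3 where F3: "map fst ps3 = h" "factors ?v ?b M3 ps3 qs3"
      using hop_factor[OF v L(1) compat h(1)] by blast
    define ks where "ks = drop (length ps) ps3"
    have split: "ps3 = take (length ps) ps3 @ ks"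
      by (simp add: ks_def)
    have "map fst (take (length ps) ps3) = take (length ps) h"
      by (simp only: take_map F3(1)[symmetric])
    also have "\<dots> = map fst ps"
      by (simp add: h_def)
    finally have "map fst ps = map fst (take (length ps) ps3)" ..
    moreover have "factors ?v ?b M3 (take (length ps) ps3) (ks @ qs3)"
      using F3(2) split by (metis factors_shift)
    \<comment> \<open>By uniqueness the longer hopping factor starts with the very parameters of
      \<open>ps\<close>, so what it has gained is exactly the mass of \<open>ks\<close>.\<close>
    ultimately have "ps = take (length ps) ps3"
      using factors_unique[OF v IH(2)] by blast
    then have ps3: "ps3 = ps @ ks"
      using split by simp
    define t where "t = nat (pos h (int s) mod int n)"
    have comm: "pos (s # h) = pos (h @ [t])"
      by (rule pos_commute[OF h(2)]) (simp only: t_def letter_mod)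
    have F4: "factors i a (Suc M3) ((s, a 0) # ps3) qs3"
      unfolding s_def by (rule factors_Cons[OF i v(1) F3(2)])
    note G = factorsD[OF F4]
    have rd1: "reduced_list (s # h)"
      using reduced_list_appendD(1)[OF G(3)] by (simp add: F3(1))
    have rd2: "reduced_list (h @ [t])"
      using reduced_list_letters[OF rd1] letter_lt
        by (intro reduced_list_cong[OF rd1 _ comm[symmetric]]) (auto simp: t_def)
    have "same_matrices (map fst ((s, a 0) # ps3)) (h @ [t])"
      using same_matrices_if_reduced[OF rd1 rd2 comm] by (simp add: F3(1))
    then obtain us where us: "map fst us = h @ [t]" "positive us"
      "word_matrix us = word_matrix ((s, a 0) # ps3)"
      using same_matricesE[OF _ G(1)] by metis
    then obtain ps4 c where ps4: "us = ps4 @ [(t, c)]" "map fst ps4 = h"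
      by (cases us rule: rev_cases) auto
    have pp4: "positive ps4" "0 < c"
      using us(2) ps4(1) by simp_all
    have pp3: "positive ps" "positive ks"
      using factorsD(1)[OF F3(2)] ps3 by simp_all
    have E4: "word_matrix ((s, a 0) # ps @ ks) = word_matrix (ps4 @ [(t, c)])"
      using us(3) ps4(1) ps3 by simp
    have "length (ps @ ks) = length h"
      using F3(1) ps3 by (metis length_map)
    then have long: "n * (n + length ps) \<le> length (ps @ ks)"
      using k1(2) by (simp add: h_def)
    have c: "c \<le> mass ks"
      using exit_bound[OF _ L(1) long pp3 pp4(1) a0 E4] h(1) F3(1) ps3 by simp
    have "a 0 + mass ps3 = mass ps4 + c"
    proof -
      have "fst ` set ((s, a 0) # ps3) \<subseteq> {..<n}"
        using reduced_list_letters[OF rd1] unfolding F3(1)[symmetric] by auto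
      moreover have "fst ` set us \<subseteq> {..<n}"
        using reduced_list_letters[OF rd2] unfolding us(1)[symmetric] by auto
      ultimately show ?thesis
        using mass_eqI[OF us(3)] ps4(1) by simp
    qed
    \<comment> \<open>The balance gives mass ps4 = a 0 + mass ps + mass ks - c with c at most mass
      ks. The mass of \<open>ks\<close> pays for the outgoing parameter, so all of a 0 is gained and
      the error does not grow with N.\<close>
    then have "(\<Sum>k<Suc N. a k) - e < mass ps4"
      unfolding sum using IH(3) c ps3 by simp
    moreover have "hop L (map fst ps4)"
      using h(1) ps4(2) by simp
    moreover have "factors i a (Suc M3) ps4 ((t, c) # qs3)"
    proof -
      have fst: "map fst (ps4 @ (t, c) # qs3) = (h @ [t]) @ map fst qs3"
        by (simp add: ps4(2))
      have "pos ((h @ [t]) @ map fst qs3) = pos ((s # h) @ map fst qs3)"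
        by (rule pos_append_cong[OF comm[symmetric] refl])
      moreover have "map fst ((s, a 0) # ps3) @ map fst qs3 = (s # h) @ map fst qs3"
        by (simp add: F3(1))
      ultimately have pos: "pos (map fst (ps4 @ (t, c) # qs3)) =
          pos (map fst ((s, a 0) # ps3) @ map fst qs3)"
        unfolding fst by simp
      have "set (map fst (ps4 @ (t, c) # qs3)) \<subseteq> {..<n}"
        unfolding fst using reduced_list_letters[OF rd2] reduced_list_letters[OF G(3)] by simp
      moreover have "length (map fst (ps4 @ (t, c) # qs3)) =
          length (map fst ((s, a 0) # ps3) @ map fst qs3)"
        unfolding fst by (simp add: F3(1)[symmetric])
      ultimately have reduced_list: "reduced_list (map fst (ps4 @ (t, c) # qs3))"
        by (rule reduced_list_cong[OF G(3) _ pos])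
      have "word_matrix (ps4 @ (t, c) # qs3) = mult_word (word_matrix us) qs3"
        by (simp add: ps4(1) mult_word_append)
      also have "\<dots> = word_matrix (prefix_pairs i a (Suc M3))"
        unfolding us(3) using G(5) by (simp add: mult_word_append)
      finally show ?thesis
        unfolding factors_def using pos reduced_list G(2,4) pp4 by simp
    qed
    ultimately show ?thesis by blast
  qed
qed

subsection \<open>Directions of infinite reduced words\<close>

text \<open>A letter moves one residue class up by one and a different one down by one.\<close>

lemma sum_pos: "(\<Sum>x\<in>{0..<int n}. pos u x) = (\<Sum>x\<in>{0..<int n}. x)"
proof (induction u rule: rev_induct)
  case Nil
  then show ?case by simp
next
  case (snoc t u)
  obtain x0 where x0: "pos u x0 = int t"
    by (rule pos_surj)
  obtain x1 where x1: "pos u x1 = int t + 1"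
    by (rule pos_surj)
  have "pos (u @ [t]) x = pos u x + (if x mod int n = x0 mod int n then 1 else 0)
      + (if x mod int n = x1 mod int n then - 1 else 0)" for x
    using pos_mod_cong[of u x x0] pos_mod_cong[of u x x1] mod_Suc_neq[of "int t"]
    unfolding x0 x1 by (auto simp: pos_append simple_refl_def)
  then show ?case
    by (simp only: sum.distrib sum_residue snoc.IH)
qed

lemma pos_eqI:
  assumes "\<And>x. x \<in> {0..<int n} \<Longrightarrow> pos u x = pos v x"
  shows "pos u = pos v"
proof (rule ext)
  fix x
  have x: "x = x mod int n + (x div int n) * int n"
    by simp
  have "x mod int n \<in> {0..<int n}"
    using n2 by simp
  from assms[OF this] show "pos u x = pos v x"
    by (subst (1 2) x) (simp only: pos_shift)
qed

text \<open>If all relative displacements stayed bounded, the conserved sum of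
  \<open>sum_pos\<close> would confine the sites of one period to a finite range. Only finitely many
  permutations would occur, but prefixes of a reduced word have different lengths and so different
  permutations.\<close>

lemma ex_unbounded:
  assumes j: "reduced_seq j"
  shows "\<exists>x y. \<forall>k. \<exists>M. pos (map j [0..<M]) (y + k * int n) < pos (map j [0..<M]) x"
proof (rule ccontr)
  let ?P = "\<lambda>M. pos (map j [0..<M])"
  let ?I = "{0..<int n}"
  assume "\<not> ?thesis"
  then have "\<forall>x y. \<exists>k. \<forall>M. ?P M x \<le> ?P M y + k * int n"
    unfolding pos_shift by (simp add: not_less)
  then obtain K where K: "\<And>x y M. ?P M x \<le> ?P M y + K x y * int n"
    by metis
  define B where "B = (\<Sum>x\<in>?I. \<Sum>y\<in>?I. \<bar>K x y * int n\<bar>)"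
  have B: "?P M x \<le> ?P M y + B" if "x \<in> ?I" "y \<in> ?I" for x y M
  proof -
    have "\<bar>K x y * int n\<bar> \<le> (\<Sum>y\<in>?I. \<bar>K x y * int n\<bar>)"
      using that by (intro member_le_sum) auto
    also have "\<dots> \<le> B"
      unfolding B_def using that
        by (intro member_le_sum[where f = "\<lambda>x. \<Sum>y\<in>?I. \<bar>K x y * int n\<bar>"]) (auto intro: sum_nonneg)
    finally show ?thesis
      using K[of M x y] by linarith
  qed
  define T where "T = (\<Sum>x\<in>?I. x)"
  define C where "C = \<bar>T\<bar> + \<bar>B\<bar>"
  have bound: "?P M x \<in> {- C..C}" if x: "x \<in> ?I" for x M
  proof -
    have T: "(\<Sum>y\<in>?I. ?P M y) = T"
      unfolding T_def by (rule sum_pos)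
    have "(\<Sum>y\<in>?I. ?P M x) \<le> (\<Sum>y\<in>?I. ?P M y + B)"
      by (intro sum_mono B x)
    then have 1: "int n * ?P M x \<le> T + int n * B"
      by (simp add: sum.distrib T)
    have "(\<Sum>y\<in>?I. ?P M y) \<le> (\<Sum>y\<in>?I. ?P M x + B)"
      by (intro sum_mono B x)
    then have 2: "T \<le> int n * ?P M x + int n * B"
      by (simp add: sum.distrib T distrib_left)
    have T': "\<bar>T\<bar> \<le> int n * \<bar>T\<bar>" "int n * B \<le> int n * \<bar>B\<bar>"
      using n2 by (simp_all add: mult_le_cancel_right1)
    have "int n * ?P M x \<le> int n * C"
      unfolding C_def distrib_left using 1 T' by linarith
    then have "?P M x \<le> C"
      using n2 by simp
    moreover have "int n * (- C) \<le> int n * ?P M x"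
      unfolding C_def minus_add_distrib distrib_left mult_minus_right using 2 T' by linarith
    then have "- C \<le> ?P M x"
      using n2 by (simp only: mult_le_cancel_left)
    ultimately show ?thesis
      by simp
  qed
  define F where "F = (\<lambda>M. restrict (?P M) ?I)"
  have "F M \<in> ?I \<rightarrow>\<^sub>E {- C..C}" for M
    using bound by (auto simp: F_def)
  then have "range F \<subseteq> ?I \<rightarrow>\<^sub>E {- C..C}"
    by auto
  moreover have "finite (?I \<rightarrow>\<^sub>E {- C..C})"
    by (intro finite_PiE) auto
  ultimately have "finite (range F)"
    by (rule finite_subset)
  moreover have "inj F"
  proof (rule injI)
    fix M M' assume "F M = F M'"
    have "?P M = ?P M'"
    proof (rule pos_eqI)
      fix x assume "x \<in> ?I"
      then show "?P M x = ?P M' x"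
        using fun_cong[OF \<open>F M = F M'\<close>, of x] by (simp add: F_def)
    qed
    then show "M = M'"
      using reduced_list_length_eq[OF reduced_list_prefix[OF j, of M] reduced_list_prefix[OF j,
          of M']] by simp
  qed
  ultimately show False
    using finite_imageD infinite_UNIV_nat by blast
qed

text \<open>
  \<open>L\<close> consists of the values that overtake \<open>x0\<close> together with all their translates: they move
  infinitely far to the left relative to \<open>x0\<close>.
\<close>

lemma ex_compat:
  assumes "reduced_seq j"
  obtains L x y where "periodic L" "compat j L" "x \<notin> L" "y \<in> L"
proof -
  let ?P = "\<lambda>M. pos (map j [0..<M])"
  obtain x0 y0 where xy0: "\<forall>k. \<exists>M. ?P M (y0 + k * int n) < ?P M x0"
    using ex_unbounded[OF assms] by blast
  define L where "L = {z. \<forall>k. \<exists>M. ?P M (z + k * int n) < ?P M x0}"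
  have "periodic L"
    unfolding periodic_def
  proof (intro allI)
    fix x k
    have "x \<in> L" if x: "x + k * int n \<in> L" for x k
      unfolding L_def
    proof (intro CollectI allI)
      fix l
      have "\<exists>M. ?P M (x + k * int n + (l - k) * int n) < ?P M x0"
        using x unfolding L_def by blast
      moreover have "x + k * int n + (l - k) * int n = x + l * int n"
        by (simp add: left_diff_distrib)
      ultimately show "\<exists>M. ?P M (x + l * int n) < ?P M x0"
        by simp
    qed
    from this[of x k] this[of "x + k * int n" "- k"] show "x + k * int n \<in> L \<longleftrightarrow> x \<in> L"
      by auto
  qed
  moreover have "compat j L"
    unfolding compat_def
  proof (intro allI impI)
    fix x y assume "x \<notin> L" "y \<in> L"
    \<comment> \<open>A value outside L never falls more than k periods behind \<open>x0\<close>,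
      whereas y gets further to the left than that.\<close>
    then obtain k where k: "\<And>M. ?P M x0 \<le> ?P M x + k * int n"
      unfolding L_def mem_Collect_eq pos_shift not_all not_ex not_less by blast
    obtain M where M: "?P M y + k * int n < ?P M x0"
      using \<open>y \<in> L\<close> unfolding L_def mem_Collect_eq pos_shift by blast
    have "?P M y < ?P M x"
      using M k[of M] by linarith
    then show "\<exists>M. ?P M y < ?P M x" ..
  qed
  moreover have "x0 \<notin> L"
  proof
    assume "x0 \<in> L"
    then have "\<exists>M. ?P M (x0 + 0 * int n) < ?P M x0"
      unfolding L_def by blast
    then show False by simp
  qed
  moreover have "y0 \<in> L"
    using xy0 by (simp add: L_def)
  ultimately show ?thesis
    using that by blast
qed

subsection \<open>Limits of transported parameters\<close>

lemma transports_eventually_agree: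
  assumes "W 0 = i" "transports_along n W a A" "admissible (i, a)"
  shows "admissible (W k, A k) \<and> eventually_agree (i, a) (W k, A k)"
proof (induction k)
  case 0
  then show ?case
    using assms by (simp add: transports_along_def eventually_agree_refl)
next
  case (Suc k)
  have "(transport_move n)\<^sup>*\<^sup>* (W k, A k) (W (Suc k), A (Suc k))"
    using assms(2) by (simp add: transports_along_def)
  from transport_eventually_agree[OF this] Suc show ?case
    using eventually_agree_trans by blast
qed

lemma braid_limit_prefix:
  assumes "braid_limit n W i j"
  shows "\<exists>K. \<forall>k\<ge>K. \<forall>l<m. W k l = j l"
proof -
  have "\<forall>\<^sub>F k in sequentially. \<forall>l\<in>{..<m}. W k l = j l"
    using assms by (intro eventually_ball_finite) (auto simp: braid_limit_def)
  then show ?thesis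
    unfolding eventually_sequentially lessThan_iff Ball_def .
qed

text \<open>Stages of either braid limit agree eventually with i, hence with each other, and
  \<open>eventually_agree_prefix\<close> applies once their first m + 1 letters are those of j.
  Taking both limits equal gives stabilisation; taking them different gives independence of the
  choice.\<close>

lemma transports_stable:
  assumes i: "reduced_seq i" "admissible (i, a)"
    and W: "braid_limit n W i j" "transports_along n W a A"
    and W': "braid_limit n W' i j" "transports_along n W' a A'"
  shows "\<exists>K. \<forall>k\<ge>K. \<forall>k'\<ge>K. A k m = A' k' m"
proof -
  obtain K K' where K: "\<forall>k\<ge>K. \<forall>l<Suc m. W k l = j l" "\<forall>k\<ge>K'. \<forall>l<Suc m. W' k l = j l"
    using braid_limit_prefix[OF W(1)] braid_limit_prefix[OF W'(1)] by metis
  have "A k m = A' k' m" if k: "k \<ge> max K K'" "k' \<ge> max K K'" for k k'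
  proof -
    have s: "admissible (W k, A k)" "eventually_agree (i, a) (W k, A k)"
      using transports_eventually_agree[OF _ W(2) i(2)] W(1) by (auto simp: braid_limit_def)
    have s': "admissible (W' k', A' k')" "eventually_agree (i, a) (W' k', A' k')"
      using transports_eventually_agree[OF _ W'(2) i(2)] W'(1) by (auto simp: braid_limit_def)
    have "eventually_agree (W' k', A' k') (W k, A k)"
      using eventually_agree_trans[OF eventually_agree_sym[OF s'(2)] s(2)] .
    then show ?thesis
    proof (rule eventually_agree_prefix[OF reduced_seq_eventually_agree[OF i(1) s'(2,1)] s'(1)
        s(1), where m = "Suc m"])
      show "W k l = W' k' l" if "l < Suc m" for l
        using K k that by simp
    qed simp
  qed
  then show ?thesis by blast
qed

lemma ex_transports:
  assumes "braid_limit n W i j"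
  obtains A where "transports_along n W a A"
proof -
  have step: "\<exists>b'. (transport_move n)\<^sup>*\<^sup>* (W k, b) (W (Suc k), b')" for k b
    using assms braid_moves_transport[of "W k" "W (Suc k)" b] by (simp add: braid_limit_def)
  define A where "A = rec_nat a (\<lambda>k b. SOME b'. (transport_move n)\<^sup>*\<^sup>* (W k, b) (W (Suc k), b'))"
  have "(transport_move n)\<^sup>*\<^sup>* (W k, A k) (W (Suc k), A (Suc k))" for k
    using someI_ex[OF step[of k "A k"]] by (simp add: A_def)
  then have "transports_along n W a A"
    by (simp add: transports_along_def A_def)
  then show ?thesis ..
qed

text \<open>One late stage of the braid limit already has the first m letters and parameters of the
  limit and is still a finite rearrangement of i. This stage stands in for j, which need not agree
  eventually with i itself.\<close>

lemma braid_R_prefix: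
  assumes i: "reduced_seq i" "admissible (i, a)" and W: "braid_limit n W i j"
  shows "\<exists>w b. admissible (w, b) \<and> eventually_agree (i, a) (w, b) \<and> (\<forall>k<m. w k = j k
      \<and> b k = braid_R n i j a k)"
proof -
  obtain A where A: "transports_along n W a A"
    using ex_transports[OF W] by blast
  have "\<exists>K. \<forall>k\<ge>K. \<forall>k'\<ge>K. A k m = A k' m" for m
    by (rule transports_stable[OF i W A W A])
  then obtain K where K: "\<And>m k k'. k \<ge> K m \<Longrightarrow> k' \<ge> K m \<Longrightarrow> A k m = A k' m"
    by metis
  define b where "b = (\<lambda>m. A (K m) m)"
  have b: "A k m = b m" if "k \<ge> K m" for k m
    unfolding b_def using K[OF that] by simp
  have lim: "(\<lambda>k. A k m) \<longlonglongrightarrow> b m" for m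
    using b by (intro tendsto_eventually) (auto simp: eventually_sequentially)
  have "braid_R n i j a = b"
    unfolding braid_R_def
  proof (rule the_equality)
    show "\<exists>W A. braid_limit n W i j \<and> transports_along n W a A \<and> (\<forall>m. (\<lambda>k. A k m) \<longlonglongrightarrow> b m)"
      using W A lim by blast
    fix b' assume "\<exists>W A. braid_limit n W i j \<and> transports_along n W a A \<and> (\<forall>m. (\<lambda>k. A k m) \<longlonglongrightarrow> b' m)"
    then obtain W' A' where W': "braid_limit n W' i j" "transports_along n W' a A'"
      and lim': "\<And>m. (\<lambda>k. A' k m) \<longlonglongrightarrow> b' m"
      by blast
    show "b' = b"
    proof (rule ext)
      fix m
      obtain K' where K': "\<forall>k\<ge>K'. \<forall>k'\<ge>K'. A k m = A' k' m"
        using transports_stable[OF i W A W', of m] by blast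
      have "(\<lambda>k. A k m) \<longlonglongrightarrow> b' m"
      proof (rule Lim_transform_eventually[OF lim'[of m]])
        show "\<forall>\<^sub>F k in sequentially. A' k m = A k m"
          using K' unfolding eventually_sequentially by (metis order_refl)
      qed
      then show "b' m = b m"
        using lim[of m] LIMSEQ_unique by blast
    qed
  qed
  moreover obtain K0 where K0: "\<forall>k\<ge>K0. \<forall>l<m. W k l = j l"
    using braid_limit_prefix[OF W] by blast
  define k where "k = Max (insert K0 (K ` {..<m}))"
  have k: "k \<ge> K0" "\<And>l. l < m \<Longrightarrow> k \<ge> K l"
    by (simp_all add: k_def)
  have "admissible (W k, A k) \<and> eventually_agree (i, a) (W k, A k)"
    using transports_eventually_agree[OF _ A i(2)] W by (simp add: braid_limit_def)
  ultimately show ?thesis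
    using K0 k b by (intro exI[of _ "W k"] exI[of _ "A k"]) simp
qed

subsection \<open>Convergence\<close>

text \<open>By \<open>mult_word_superdiag_le\<close> each further diagonal costs at most a factor
  S.\<close>

lemma word_matrix_bound: "\<exists>B. \<forall>ps. positive ps \<longrightarrow> mass ps \<le> S \<longrightarrow> word_matrix ps r (r + int d) \<le> B"
proof (induction d)
  case 0
  have "word_matrix ps r r = 1" for ps
    using unitri_mult_word[OF unitri_one] by (simp add: unitri_def)
  then show ?case by auto
next
  case (Suc d)
  then obtain B where B: "\<And>ps. positive ps \<Longrightarrow> mass ps \<le> S \<Longrightarrow> word_matrix ps r (r + int d) \<le> B"
    by blast
  have "word_matrix ps r (r + int (Suc d)) \<le> S * B" if ps: "positive ps" "mass ps \<le> S" for ps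
  proof -
    have nn: "nonneg (word_matrix ps)"
      using ps nonneg_mult_word nonneg_one by blast
    have "word_matrix ps r (r + int d + 1)
        \<le> unfolded_one r (r + int d + 1) + mass ps * word_matrix ps r (r + int d)"
      by (rule mult_word_superdiag_le[OF nonneg_one ps(1)])
    also have "\<dots> = mass ps * word_matrix ps r (r + int d)"
      by (simp add: unfolded_one_def)
    also have "\<dots> \<le> S * B"
      using ps mass_nonneg[OF ps(1)] B[OF ps] nn by (intro mult_mono) (auto simp: nonneg_def)
    finally show ?thesis
      by (simp only: of_nat_Suc ac_simps)
  qed
  then show ?case by blast
qed

lemma word_matrix_bounded: "\<exists>B. \<forall>ps. positive ps \<longrightarrow> mass ps \<le> S \<longrightarrow> word_matrix ps r c \<le> B"
proof (cases "r \<le> c")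
  case True
  then obtain d where "c = r + int d"
    using zle_iff_zadd by blast
  then show ?thesis
    using word_matrix_bound by simp
next
  case False
  have "word_matrix ps r c = 0" for ps
    using unitri_mult_word[OF unitri_one] False by (simp add: unitri_def)
  then show ?thesis by auto
qed

lemma prefix_pairs_mono:
  assumes "admissible (w, a)" "m \<le> M"
  shows "word_matrix (prefix_pairs w a m) r c \<le> word_matrix (prefix_pairs w a M) r c"
proof -
  have "positive (map (\<lambda>k. (w k, a k)) [m..<M])"
    using assms(1) by (auto simp: positive_def admissible_def)
  moreover have "nonneg (word_matrix (prefix_pairs w a m))"
    using nonneg_mult_word[OF nonneg_one positive_prefix_pairs[OF assms(1)]] .
  ultimately show ?thesis
    unfolding prefix_pairs_split[OF assms(2)] mult_word_append by (intro mult_word_ge)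
qed

text \<open>A hopping word can be split off from both i and j. It carries all but e of the sum of a,
  and uniqueness gives it the same parameters in j; so a prefix of j long enough to contain it
  leaves less than e to its cofactor.\<close>

lemma small_remainder:
  assumes i: "reduced_seq i" "admissible (i, a)" "summable a" and j: "reduced_seq j"
    "admissible (j, b)"
    and pre: "\<And>m. \<exists>M qs. factors i a M (prefix_pairs j b m) qs" and e: "0 < e"
  shows "\<exists>m. \<forall>M qs. factors i a M (prefix_pairs j b m) qs \<longrightarrow> mass qs < e"
proof -
  have a: "\<And>k. 0 \<le> a k"
    using i(2) by (simp add: admissible_def less_imp_le)
  obtain L x y where L: "periodic L" "compat j L" "x \<notin> L" "y \<in> L"
    using ex_compat[OF j(1)] by blast
  \<comment> \<open>A prefix of j is an initial factor of a reduced form of some prefix of i, and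
    inversions persist when a reduced word is continued.\<close>
  have "compat i L"
    unfolding compat_def
  proof (intro allI impI)
    fix x y assume xy: "x \<notin> L" "y \<in> L" "x < y"
    then obtain m where m: "pos (map j [0..<m]) y < pos (map j [0..<m]) x"
      using L(2) unfolding compat_def by blast
    obtain M qs where F: "factors i a M (prefix_pairs j b m) qs"
      using pre by blast
    have reduced_list: "reduced_list (map j [0..<m] @ map fst qs)"
      using factorsD(3)[OF F] by (simp add: map_fst_prefix_pairs)
    have "pos (map j [0..<m] @ u) y
        < pos (map j [0..<m] @ u) x" if "reduced_list (map j [0..<m] @ u)" for u
      using that
    proof (induction u rule: rev_induct)
      case Nil
      then show ?case using m by simp
    next
      case (snoc t u)
      have reduced_list: "reduced_list ((map j [0..<m] @ u) @ [t])"
        using snoc.prems by simp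
      from inversion_snoc[OF reduced_list xy(3) snoc.IH[OF reduced_list_appendD(1)[OF
          reduced_list]]] show ?case
        by simp
    qed
    from this[OF reduced_list] show "\<exists>M. pos (map i [0..<M]) y < pos (map i [0..<M]) x"
      using factorsD(4)[OF F] unfolding map_fst_prefix_pairs by metis
  qed
  obtain N where N: "suminf a - e / 2 < (\<Sum>k<N. a k)"
  proof -
    have "(\<lambda>N. \<Sum>k<N. a k) \<longlonglongrightarrow> suminf a"
      by (rule summable_LIMSEQ[OF i(3)])
    then have "\<forall>\<^sub>F N in sequentially. suminf a - e / 2 < (\<Sum>k<N. a k)"
      by (rule order_tendstoD) (use e in simp)
    then show ?thesis
      using that by (auto simp: eventually_sequentially)
  qed
  obtain M ps qs where F: "hop L (map fst ps)" "factors i a M ps qs" "(\<Sum>k<N. a k) - e / 2 < mass ps"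
    using hop_mass[OF i(1,2) L(1) \<open>compat i L\<close> L(3,4), of "e / 2" N] e by auto
  obtain m ps' qs' where F': "map fst ps' = map fst ps" "factors j b m ps' qs'"
    using hop_factor[OF j L(1,2) F(1)] by blast
  have "mass rs < e" if R: "factors i a M' (prefix_pairs j b m) rs" for M' rs
  proof -
    note G = factorsD[OF R] and G' = factorsD[OF F'(2)]
    have fst: "map fst (ps' @ qs' @ rs) = (map fst ps' @ map fst qs') @ map fst rs"
      by simp
    have pos: "pos (map fst (ps' @ qs' @ rs)) = pos (map fst (prefix_pairs j b m) @ map fst rs)"
      unfolding fst map_fst_prefix_pairs by (rule pos_append_cong[OF G'(4) refl])
    have "set (map fst (ps' @ qs' @ rs)) \<subseteq> {..<n}"
      unfolding fst using reduced_list_letters[OF G'(3)] reduced_list_letters[OF G(3)] by auto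
    moreover have "length (map fst (ps' @ qs' @ rs)) =
        length (map fst (prefix_pairs j b m) @ map fst rs)"
      using factors_length[OF j(1) F'(2)] by simp
    ultimately have reduced_list: "reduced_list (map fst (ps' @ qs' @ rs))"
      by (rule reduced_list_cong[OF G(3) _ pos])
    have "word_matrix (ps' @ qs' @ rs) = mult_word (word_matrix (ps' @ qs')) rs"
      by (simp add: mult_word_append)
    also have "\<dots> = word_matrix (prefix_pairs i a M')"
      unfolding G'(5) using G(5) by (simp add: mult_word_append)
    finally have "factors i a M' ps' (qs' @ rs)"
      unfolding factors_def using pos reduced_list G G' by simp
    \<comment> \<open>Seen through the prefix of j, \<open>ps'\<close> is an initial factor of i
      with the letters of \<open>ps\<close>.\<close>
    then have "ps' = ps"
      using factors_unique[OF i(1,2) _ F(2)] F'(1) by blast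
    have "mass (prefix_pairs j b m) + mass rs = (\<Sum>k<M'. a k)"
      by (rule factors_msum[OF i(1) R])
    moreover have "(\<Sum>k<M'. a k) \<le> suminf a"
      using a by (intro sum_le_suminf i(3)) auto
    moreover have "mass (prefix_pairs j b m) = mass ps' + mass qs'"
      using factors_msum[OF j(1) F'(2)] by (simp add: mass_prefix_pairs)
    ultimately show ?thesis
      using F(3) N mass_nonneg[OF G'(2)] unfolding \<open>ps' = ps\<close> by linarith
  qed
  then show ?thesis by blast
qed

text \<open>Entrywise both sequences of prefixes increase. That prefixes of j are left factors gives
  one inequality; the other holds because a cofactor of small mass changes an entry by
  little.\<close>

lemma chevalley_word_braid_R:
  assumes red: "reduced_word n i"
    "reduced_word n j" and W: "braid_limit n W i j" and a: "a \<in> ell1_pos"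
  shows "chevalley_word n i a = chevalley_word n j (braid_R n i j a)"
proof (intro ext)
  fix r c
  define b where "b = braid_R n i j a"
  have reduced_seq: "reduced_seq i" "reduced_seq j"
    using red reduced_seq_if_reduced_word by auto
  have summable: "summable a" and gi: "admissible (i, a)"
    using a reduced_seq_letter[OF reduced_seq(1)] by (auto simp: ell1_pos_def admissible_def)
  note i = reduced_seq(1) gi
  have prefix: "\<exists>w b'. admissible (w, b') \<and> eventually_agree (i, a) (w, b') \<and> (\<forall>k<m. w k = j k
      \<and> b' k = b k)" for m
    unfolding b_def by (rule braid_R_prefix[OF i W])
  have gj: "admissible (j, b)"
    unfolding admissible_def
  proof
    fix k
    obtain w b' where w: "admissible (w, b')" "\<forall>l<Suc k. w l = j l \<and> b' l = b l"
      using prefix[of "Suc k"] by blast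
    have "w k < n" "0 < b' k"
      using w(1) by (simp_all add: admissible_def)
    moreover have "w k = j k" "b' k = b k"
      using w(2) by blast+
    ultimately show "fst (j, b) k < n \<and> 0 < snd (j, b) k"
      by (metis fst_conv snd_conv)
  qed
  have fac: "\<exists>M0. \<forall>M\<ge>M0. \<exists>qs. factors i a M (prefix_pairs j b m) qs" for m
  proof -
    obtain w b' where w: "admissible (w, b')" "eventually_agree (i, a) (w, b')"
      "\<forall>k<m. w k = j k \<and> b' k = b k"
      using prefix[of m] by blast
    have rw: "reduced_seq w"
      by (rule reduced_seq_eventually_agree[OF reduced_seq(1) w(2,1)])
    obtain M0 where M0: "\<And>M. M0 \<le> M
        \<Longrightarrow> word_matrix (prefix_pairs i a M) = word_matrix (prefix_pairs w b' M)"
      "\<And>M. M0 \<le> M \<Longrightarrow> pos (map i [0..<M]) = pos (map w [0..<M])"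
      using eventually_agreeE[OF w(2)] by metis
    have pre: "prefix_pairs w b' m = prefix_pairs j b m"
      using w(3) by (simp add: prefix_pairs_def)
    have "\<exists>qs. factors i a M (prefix_pairs j b m) qs" if M: "M \<ge> max m M0" for M
    proof -
      let ?t = "map (\<lambda>k. (w k, b' k)) [m..<M]"
      have split: "prefix_pairs j b m @ ?t = prefix_pairs w b' M"
        using prefix_pairs_split[of m M w b'] M pre by simp
      have "factors i a M (prefix_pairs j b m) ?t"
        unfolding factors_def split map_fst_prefix_pairs
        using positive_prefix_pairs[OF w(1)] reduced_list_prefix[OF rw] M0[of M] M by simp
      then show ?thesis by blast
    qed
    then show ?thesis by blast
  qed
  let ?S = "suminf a"
  have a0: "\<And>k. 0 \<le> a k"
    using gi by (simp add: admissible_def less_imp_le)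
  have Si: "mass (prefix_pairs i a M) \<le> ?S" for M
    unfolding mass_prefix_pairs using a0 by (intro sum_le_suminf summable) auto
  obtain B0 where B0: "\<And>M. word_matrix (prefix_pairs i a M) r c \<le> B0"
    using word_matrix_bounded[of ?S r c] positive_prefix_pairs[OF gi] Si by blast
  obtain B1 where B1: "\<And>M. word_matrix (prefix_pairs i a M) r (c - 1) \<le> B1"
    using word_matrix_bounded[of ?S r "c - 1"] positive_prefix_pairs[OF gi] Si by blast
  have nn: "0 \<le> word_matrix (prefix_pairs i a M) r c'" for M c'
    using nonneg_mult_word[OF nonneg_one positive_prefix_pairs[OF gi, of M]]
      by (simp add: nonneg_def)
  have B1nn: "0 \<le> B1"
    using nn B1 order_trans by blast
  define f where "f = (\<lambda>M. word_matrix (prefix_pairs i a M) r c)"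
  define g where "g = (\<lambda>m. word_matrix (prefix_pairs j b m) r c)"
  have "incseq f" "incseq g"
    unfolding f_def g_def by (intro incseq_SucI prefix_pairs_mono gi gj; simp)+
  have gf: "\<exists>M. g m \<le> f M" for m
  proof -
    obtain M qs where F: "factors i a M (prefix_pairs j b m) qs"
      using fac[of m] by blast
    have "g m \<le> mult_word (word_matrix (prefix_pairs j b m)) qs r c"
      unfolding g_def by (intro mult_word_ge nonneg_mult_word[OF nonneg_one
          positive_prefix_pairs[OF gj]] factorsD(2)[OF F])
    also have "\<dots> = f M"
      unfolding f_def factorsD(5)[OF F, symmetric] mult_word_append ..
    finally show ?thesis by blast
  qed
  have fB: "\<And>M. f M \<le> B0"
    using B0 by (simp add: f_def)
  obtain X where X: "f \<longlonglongrightarrow> X" "\<And>M. f M \<le> X"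
    using incseq_convergent[OF \<open>incseq f\<close>] fB by blast
  have gX: "\<And>m. g m \<le> X"
    using gf X(2) order_trans by blast
  obtain Y where Y: "g \<longlonglongrightarrow> Y" "\<And>m. g m \<le> Y"
    using incseq_convergent[OF \<open>incseq g\<close>] gX by blast
  have "Y \<le> X"
    using Y(1) gX by (intro LIMSEQ_le_const2) auto
  moreover have "X \<le> Y"
  proof (rule field_le_epsilon)
    fix d :: real assume d: "0 < d"
    \<comment> \<open>The summand 1 keeps the denominator positive, as B1 may be zero, for instance
      below the diagonal.\<close>
    define e where "e = d / (B1 + 1)"
    have e: "0 < e"
      using d B1nn by (simp add: e_def)
    have "\<exists>M qs. factors i a M (prefix_pairs j b m) qs" for m
      using fac[of m] by blast
    then obtain m where m: "\<And>M qs. factors i a M (prefix_pairs j b m) qs \<Longrightarrow> mass qs < e"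
      using small_remainder[OF i summable reduced_seq(2) gj _ e] by blast
    obtain M0 where M0: "\<And>M. M0 \<le> M \<Longrightarrow> \<exists>qs. factors i a M (prefix_pairs j b m) qs"
      using fac[of m] by blast
    have "f M \<le> Y + d" for M
    proof -
      obtain qs where F: "factors i a (max M M0) (prefix_pairs j b m) qs"
        using M0[of "max M M0"] by auto
      have eq: "mult_word (word_matrix (prefix_pairs j b m)) qs =
          word_matrix (prefix_pairs i a (max M M0))"
        unfolding factorsD(5)[OF F, symmetric] mult_word_append ..
      have "f M \<le> f (max M M0)"
        using \<open>incseq f\<close> by (simp add: incseq_def)
      \<comment> \<open>Column c is written as c - 1 + 1 to match
        \<open>mult_word_superdiag_le\<close>; column c - 1 of the full product is then bounded by
        B1.\<close>
      also have "\<dots> = mult_word (word_matrix (prefix_pairs j b m)) qs r (c - 1 + 1)"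
        unfolding eq f_def by simp
      also have "\<dots> \<le> word_matrix (prefix_pairs j b m) r (c - 1 + 1) + mass qs * mult_word
          (word_matrix (prefix_pairs j b m)) qs r (c - 1)"
        by (intro mult_word_superdiag_le nonneg_mult_word[OF nonneg_one positive_prefix_pairs[OF
            gj]] factorsD(2)[OF F])
      also have "\<dots> = g m + mass qs * word_matrix (prefix_pairs i a (max M M0)) r (c - 1)"
        unfolding eq g_def by simp
      also have "\<dots> \<le> Y + e * B1"
        using Y(2)[of m] m[OF F] mass_nonneg[OF factorsD(2)[OF F]] B1[of "max M M0"] nn e
        by (intro add_mono mult_mono) auto
      also have "e * B1 \<le> d"
        using B1nn d by (simp add: e_def field_simps)
      finally show ?thesis by simp
    qed
    then show "X \<le> Y + d"
      using X(1) by (intro LIMSEQ_le_const2) auto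
  qed
  ultimately have XY: "X = Y" by simp
  have "chevalley_word n i a r c = X"
    unfolding chevalley_word_def using X(1) reduced_seq_letter[OF reduced_seq(1)]
    by (simp add: chevalley_prefix_eq f_def limI)
  moreover have "chevalley_word n j b r c = Y"
    unfolding chevalley_word_def using Y(1) reduced_seq_letter[OF reduced_seq(2)]
    by (simp add: chevalley_prefix_eq g_def limI)
  ultimately show "chevalley_word n i a r c = chevalley_word n j (braid_R n i j a) r c"
    using XY b_def by simp
qed

end

theorem theorem5p6:
  fixes n :: nat and i j :: word and W :: "nat \<Rightarrow> word" and a :: params
  assumes "2 \<le> n"
    and "reduced_word n i" and "reduced_word n j"
    and "braid_limit n W i j"
    and "a \<in> ell1_pos"
  shows "chevalley_word n i a = chevalley_word n j (braid_R n i j a)"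
proof -
  interpret affine_words n
    by unfold_locales (rule assms(1))
  show ?thesis
    using assms(2-5) by (rule chevalley_word_braid_R)
qed

end
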